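(* Let $\mathsf D$ be a picture with countable Kolmogorov products. If an object $A$ has a de Finetti object $(QA,\ell_A)$, then $QA$ is a state space object of $A$ with evaluation morphism $\ell_A$.
   Context: **Involutive Markov categories.** A hom-involutive symmetric monoidal category is a symmetric monoidal category $(\mathsf C,\odot,I)$ with a strict symmetric monoidal endofunctor $\phi\mapsto\overline\phi$ that is the identity on objects and whose square is the identity. An ICD-category is such a $\mathsf C$ in which every object $A$ has morphisms $\mathrm{copy}_A\colon A\to A\odot A$, $\mathrm{del}_A\colon A\to I$ such that (suppressing coherence isomorphisms): (1) $(A,\mathrm{copy}_A,\mathrm{del}_A)$ is a (coassociative, counital) comonoid; (2) $\overline{\mathrm{copy}_A}=\mathrm{swap}_{A,A}\mathrm{copy}_A$, $\overline{\mathrm{del}_A}=\mathrm{del}_A$; (3) $\mathrm{copy}_{A\odot B}=(\mathrm{id}_A\odot\mathrm{swap}_{A,B}\odot\mathrm{id}_B)(\mathrm{copy}_A\odot\mathrm{copy}_B)$, $\mathrm{del}_{A\odot B}=\mathrm{del}_A\odot\mathrm{del}_B$, $\mathrm{copy}_I=\mathrm{id}_I$, $\mathrm{del}_I=\mathrm{id}_I$. It is an involutive Markov category if all morphisms $\phi\colon A\to B$ satisfy $\mathrm{del}_B\,\phi=\mathrm{del}_A$. A morphism is self-adjoint if $\overline\phi=\phi$, and deterministic if it is self-adjoint and $\mathrm{copy}_B\,\phi=(\phi\odot\phi)\mathrm{copy}_A$; $\mathsf C_{\det}$ is the subcategory of deterministic morphisms. An object $A$ is classical if $\mathrm{swap}_{A,A}\mathrm{copy}_A=\mathrm{copy}_A$.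 For $\phi,\psi$ with common domain $A$, put $(\phi,\psi):=(\phi\odot\psi)\mathrm{copy}_A$; $\phi,\psi$ are compatible if $(\phi,\psi)=\mathrm{swap}\,(\psi,\phi)$; $\phi$ is autocompatible if compatible with itself. Put $\phi^{(0)}:=\mathrm{del}_A$, $\phi^{(n)}:=(\phi^{(n-1)},\phi)$. **Pictures.** A picture in an involutive Markov category $\mathsf C$ is a wide subcategory $\mathsf D\subseteq\mathsf C$ that (i) is a symmetric monoidal subcategory containing all delete morphisms, (ii) has only self-adjoint morphisms, and (iii) contains $(\phi,\psi)$ whenever $\phi\colon A\to B$ and $\psi\colon A\to C$ in $\mathsf D$ are compatible and $\phi$ is autocompatible. Write $\mathrm{Gen}(\mathsf D):=\mathsf C$ (its morphisms are generalized morphisms; "morphism" means in $\mathsf D$) and $\mathsf D_{\det}:=\mathsf D\cap\mathsf C_{\det}$. **Kolmogorov products.** For objects $(A_j)_{j\in J}$, write $A_F=\bigodot_{j\in F}A_j$ for finite $F\subseteq J$ and, for $F'\subseteq F$, let $\pi_{F,F'}\colon A_F\to A_{F'}$ be the identity on factors in $F'$ and delete on the others. A Kolmogorov product is an object $A_J$ with a natural bijection, for all $B,E$, between generalized morphisms $B\to A_J\odot E$ and families of generalized morphisms $(\phi_F\colon B\to A_F\odot E)_{F\text{ finite}}$ with $(\pi_{F,F'}\odot\mathrm{id}_E)\phi_F=\phi_{F'}$ for $F'\subseteq F$, restricting to natural bijections in $\mathsf D$ and in $\mathrm{Gen}(\mathsf D)_{\det}$. It comes with marginalizations $\pi_F\colon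 A_J\to A_F$. $\mathsf D$ has countable Kolmogorov products if every countable family has one; $A_{\mathbb N}$ is the Kolmogorov product of the constant family $(A)_{n\in\mathbb N}$. For $\phi\colon B\to A$, $\phi^{(\mathbb N)}\colon B\to A_{\mathbb N}$ is the generalized morphism induced by the family $(\phi^{(|F|)})_F$. For a finite permutation $\sigma$ of $\mathbb N$, $A_\sigma\colon A_{\mathbb N}\to A_{\mathbb N}$ is the unique morphism with $\pi_FA_\sigma=A_{\sigma|_F}\pi_{\sigma(F)}$ for all finite $F$, where $A_{\sigma|_F}\colon A_{\sigma(F)}\to A_F$ relabels the factor $\sigma(j)$ as the $j$-th factor. **De Finetti objects.** A de Finetti object for $A$ is an object $QA$ with a morphism $\ell_A\colon QA\to A$ of $\mathsf D$ such that: (i) $\ell_A$ is autocompatible; (ii) $\ell_A^{(\mathbb N)}\colon QA\to A_{\mathbb N}$ is the equalizer in $\mathsf D$ of all finite permutations $A_\sigma$, and this limit is preserved by $-\odot\mathrm{id}_B$ for every object $B$; (iii) $\ell_A^{(\mathbb N)}\odot\mathrm{id}_B$ is monic in $\mathrm{Gen}(\mathsf D)$ for every object $B$. **State space objects.** A state space object of $A$ is a classical object $SA$ with a morphism $\mathsf{ev}_A\colon SA\to A$ of $\mathsf D$ (the evaluation morphism) such that $\mathsf{ev}_A\circ-\colon\mathsf D_{\det}(B,SA)\to\mathsf D(B,A)$ is bijective for every classical object $B$. *)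

theory Defs
  imports "HOL-Library.FuncSet"
begin

section \<open>Symmetric monoidal categories\<close>

record ('o, 'm) category_data =
  Obj :: "'o set"
  Arr :: "'m set"
  Dom :: "'m \<Rightarrow> 'o"
  Cod :: "'m \<Rightarrow> 'o"
  Id :: "'o \<Rightarrow> 'm"
  Comp :: "'m \<Rightarrow> 'm \<Rightarrow> 'm"  (infixr "\<cdot>\<index>" 70)

definition hom :: "('o, 'm, 'x) category_data_scheme \<Rightarrow> 'o \<Rightarrow> 'o \<Rightarrow> 'm set" where
  "hom C A B = {f \<in> Arr C. Dom C f = A \<and> Cod C f = B}"

locale category =
  fixes C :: "('o, 'm, 'x) category_data_scheme" (structure)
  assumes Dom_Obj: "f \<in> Arr C \<Longrightarrow> Dom C f \<in> Obj C"
    and Cod_Obj: "f \<in> Arr C \<Longrightarrow> Cod C f \<in> Obj C"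
    and Id_hom: "A \<in> Obj C \<Longrightarrow> Id C A \<in> hom C A A"
    and Comp_hom: "f \<in> hom C A B \<Longrightarrow> g \<in> hom C B B' \<Longrightarrow> g \<cdot> f \<in> hom C A B'"
    and Id_left: "f \<in> hom C A B \<Longrightarrow> Id C B \<cdot> f = f"
    and Id_right: "f \<in> hom C A B \<Longrightarrow> f \<cdot> Id C A = f"
    and Comp_assoc: "f \<in> hom C A B \<Longrightarrow> g \<in> hom C B B' \<Longrightarrow> h \<in> hom C B' B'' \<Longrightarrow>
          (h \<cdot> g) \<cdot> f = h \<cdot> (g \<cdot> f)"

definition inverse_arrows :: "('o, 'm, 'x) category_data_scheme \<Rightarrow> 'm \<Rightarrow> 'm \<Rightarrow> bool" where
  "inverse_arrows C f g \<longleftrightarrow> f \<in> Arr C \<and> g \<in> hom C (Cod C f) (Dom C f) \<and>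
     g \<cdot>\<^bsub>C\<^esub> f = Id C (Dom C f) \<and> f \<cdot>\<^bsub>C\<^esub> g = Id C (Cod C f)"

definition is_iso :: "('o, 'm, 'x) category_data_scheme \<Rightarrow> 'm \<Rightarrow> bool" where
  "is_iso C f \<longleftrightarrow> (\<exists>g. inverse_arrows C f g)"

definition inv_arr :: "('o, 'm, 'x) category_data_scheme \<Rightarrow> 'm \<Rightarrow> 'm" where
  "inv_arr C f = (THE g. inverse_arrows C f g)"

text \<open>The tensor product is written \<open>\<odot>\<close> on objects and \<open>\<otimes>\<close> on morphisms. The monoidal structure is
  not assumed to be strict.\<close>

record ('o, 'm) monoidal_data = "('o, 'm) category_data" +
  Unit :: 'o
  TensorO :: "'o \<Rightarrow> 'o \<Rightarrow> 'o"  (infixl "\<odot>\<index>" 75)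
  TensorM :: "'m \<Rightarrow> 'm \<Rightarrow> 'm"  (infixl "\<otimes>\<index>" 75)
  Assoc :: "'o \<Rightarrow> 'o \<Rightarrow> 'o \<Rightarrow> 'm"
  Lunit :: "'o \<Rightarrow> 'm"
  Runit :: "'o \<Rightarrow> 'm"
  Swap :: "'o \<Rightarrow> 'o \<Rightarrow> 'm"

locale symmetric_monoidal_category = category C
  for C :: "('o, 'm, 'x) monoidal_data_scheme" (structure) +
  assumes Unit_Obj: "Unit C \<in> Obj C"
    and TensorO_Obj: "A \<in> Obj C \<Longrightarrow> B \<in> Obj C \<Longrightarrow> A \<odot> B \<in> Obj C"
    and TensorM_hom: "f \<in> hom C A A' \<Longrightarrow> g \<in> hom C B B' \<Longrightarrow> f \<otimes> g \<in> hom C (A \<odot> B) (A' \<odot> B')"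
    and TensorM_Id: "A \<in> Obj C \<Longrightarrow> B \<in> Obj C \<Longrightarrow> Id C A \<otimes> Id C B = Id C (A \<odot> B)"
    and TensorM_Comp: "f \<in> hom C A A' \<Longrightarrow> f' \<in> hom C A' A'' \<Longrightarrow> g \<in> hom C B B' \<Longrightarrow> g' \<in> hom C B' B'' \<Longrightarrow>
          (f' \<cdot> f) \<otimes> (g' \<cdot> g) = (f' \<otimes> g') \<cdot> (f \<otimes> g)"
    and Assoc_hom: "A \<in> Obj C \<Longrightarrow> B \<in> Obj C \<Longrightarrow> E \<in> Obj C \<Longrightarrow>
          Assoc C A B E \<in> hom C ((A \<odot> B) \<odot> E) (A \<odot> (B \<odot> E))"
    and Lunit_hom: "A \<in> Obj C \<Longrightarrow> Lunit C A \<in> hom C (Unit C \<odot> A) A"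
    and Runit_hom: "A \<in> Obj C \<Longrightarrow> Runit C A \<in> hom C (A \<odot> Unit C) A"
    and Swap_hom: "A \<in> Obj C \<Longrightarrow> B \<in> Obj C \<Longrightarrow> Swap C A B \<in> hom C (A \<odot> B) (B \<odot> A)"
    and Assoc_iso: "A \<in> Obj C \<Longrightarrow> B \<in> Obj C \<Longrightarrow> E \<in> Obj C \<Longrightarrow> is_iso C (Assoc C A B E)"
    and Lunit_iso: "A \<in> Obj C \<Longrightarrow> is_iso C (Lunit C A)"
    and Runit_iso: "A \<in> Obj C \<Longrightarrow> is_iso C (Runit C A)"
    and Assoc_natural: "f \<in> hom C A A' \<Longrightarrow> g \<in> hom C B B' \<Longrightarrow> h \<in> hom C E E' \<Longrightarrow>
          Assoc C A' B' E' \<cdot> ((f \<otimes> g) \<otimes> h) = (f \<otimes> (g \<otimes> h)) \<cdot> Assoc C A B E"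
    and Lunit_natural: "f \<in> hom C A A' \<Longrightarrow> Lunit C A' \<cdot> (Id C (Unit C) \<otimes> f) = f \<cdot> Lunit C A"
    and Runit_natural: "f \<in> hom C A A' \<Longrightarrow> Runit C A' \<cdot> (f \<otimes> Id C (Unit C)) = f \<cdot> Runit C A"
    and Swap_natural: "f \<in> hom C A A' \<Longrightarrow> g \<in> hom C B B' \<Longrightarrow>
          Swap C A' B' \<cdot> (f \<otimes> g) = (g \<otimes> f) \<cdot> Swap C A B"
    and pentagon: "A \<in> Obj C \<Longrightarrow> B \<in> Obj C \<Longrightarrow> E \<in> Obj C \<Longrightarrow> G \<in> Obj C \<Longrightarrow>
          Assoc C A B (E \<odot> G) \<cdot> Assoc C (A \<odot> B) E G =
          (Id C A \<otimes> Assoc C B E G) \<cdot> Assoc C A (B \<odot> E) G \<cdot> (Assoc C A B E \<otimes> Id C G)"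
    and triangle: "A \<in> Obj C \<Longrightarrow> B \<in> Obj C \<Longrightarrow>
          (Id C A \<otimes> Lunit C B) \<cdot> Assoc C A (Unit C) B = Runit C A \<otimes> Id C B"
    and hexagon: "A \<in> Obj C \<Longrightarrow> B \<in> Obj C \<Longrightarrow> E \<in> Obj C \<Longrightarrow>
          Assoc C B E A \<cdot> Swap C A (B \<odot> E) \<cdot> Assoc C A B E =
          (Id C B \<otimes> Swap C A E) \<cdot> Assoc C B A E \<cdot> (Swap C A B \<otimes> Id C E)"
    and Swap_Swap: "A \<in> Obj C \<Longrightarrow> B \<in> Obj C \<Longrightarrow> Swap C B A \<cdot> Swap C A B = Id C (A \<odot> B)"

section \<open>Involutive Markov categories\<close>

record ('o, 'm) involutive_data = "('o, 'm) monoidal_data" +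
  Bar :: "'m \<Rightarrow> 'm"

locale hom_involutive_smc = symmetric_monoidal_category C
  for C :: "('o, 'm, 'x) involutive_data_scheme" (structure) +
  assumes Bar_hom: "f \<in> hom C A B \<Longrightarrow> Bar C f \<in> hom C A B"
    and Bar_Id: "A \<in> Obj C \<Longrightarrow> Bar C (Id C A) = Id C A"
    and Bar_Comp: "f \<in> hom C A B \<Longrightarrow> g \<in> hom C B B' \<Longrightarrow> Bar C (g \<cdot> f) = Bar C g \<cdot> Bar C f"
    and Bar_TensorM: "f \<in> Arr C \<Longrightarrow> g \<in> Arr C \<Longrightarrow> Bar C (f \<otimes> g) = Bar C f \<otimes> Bar C g"
    and Bar_Assoc: "A \<in> Obj C \<Longrightarrow> B \<in> Obj C \<Longrightarrow> E \<in> Obj C \<Longrightarrow> Bar C (Assoc C A B E) = Assoc C A B E"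
    and Bar_Lunit: "A \<in> Obj C \<Longrightarrow> Bar C (Lunit C A) = Lunit C A"
    and Bar_Runit: "A \<in> Obj C \<Longrightarrow> Bar C (Runit C A) = Runit C A"
    and Bar_Swap: "A \<in> Obj C \<Longrightarrow> B \<in> Obj C \<Longrightarrow> Bar C (Swap C A B) = Swap C A B"
    and Bar_Bar: "f \<in> Arr C \<Longrightarrow> Bar C (Bar C f) = f"

record ('o, 'm) icd_data = "('o, 'm) involutive_data" +
  Copy :: "'o \<Rightarrow> 'm"
  Del :: "'o \<Rightarrow> 'm"

text \<open>The morphism \<open>id \<odot> swap \<odot> id\<close> from \<open>(A \<odot> A) \<odot> (B \<odot> B)\<close> to \<open>(A \<odot> B) \<odot> (A \<odot> B)\<close>, with its
  rebracketings.\<close>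

definition mid_swap :: "('o, 'm, 'x) monoidal_data_scheme \<Rightarrow> 'o \<Rightarrow> 'o \<Rightarrow> 'm" where
  "mid_swap C A B =
     inv_arr C (Assoc C A B (A \<odot>\<^bsub>C\<^esub> B)) \<cdot>\<^bsub>C\<^esub>
     (Id C A \<otimes>\<^bsub>C\<^esub> (Assoc C B A B \<cdot>\<^bsub>C\<^esub> (Swap C A B \<otimes>\<^bsub>C\<^esub> Id C B) \<cdot>\<^bsub>C\<^esub> inv_arr C (Assoc C A B B))) \<cdot>\<^bsub>C\<^esub>
     Assoc C A A (B \<odot>\<^bsub>C\<^esub> B)"

locale icd_category = hom_involutive_smc C
  for C :: "('o, 'm, 'x) icd_data_scheme" (structure) +
  assumes Copy_hom: "A \<in> Obj C \<Longrightarrow> Copy C A \<in> hom C A (A \<odot> A)"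
    and Del_hom: "A \<in> Obj C \<Longrightarrow> Del C A \<in> hom C A (Unit C)"
    and Copy_coassoc: "A \<in> Obj C \<Longrightarrow>
          Assoc C A A A \<cdot> (Copy C A \<otimes> Id C A) \<cdot> Copy C A = (Id C A \<otimes> Copy C A) \<cdot> Copy C A"
    and counit_left: "A \<in> Obj C \<Longrightarrow> Lunit C A \<cdot> (Del C A \<otimes> Id C A) \<cdot> Copy C A = Id C A"
    and counit_right: "A \<in> Obj C \<Longrightarrow> Runit C A \<cdot> (Id C A \<otimes> Del C A) \<cdot> Copy C A = Id C A"
    and Bar_Copy: "A \<in> Obj C \<Longrightarrow> Bar C (Copy C A) = Swap C A A \<cdot> Copy C A"
    and Bar_Del: "A \<in> Obj C \<Longrightarrow> Bar C (Del C A) = Del C A"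
    and Copy_tensor: "A \<in> Obj C \<Longrightarrow> B \<in> Obj C \<Longrightarrow>
          Copy C (A \<odot> B) = mid_swap C A B \<cdot> (Copy C A \<otimes> Copy C B)"
    and Del_tensor: "A \<in> Obj C \<Longrightarrow> B \<in> Obj C \<Longrightarrow>
          Del C (A \<odot> B) = Lunit C (Unit C) \<cdot> (Del C A \<otimes> Del C B)"
    and Copy_Unit: "Copy C (Unit C) = inv_arr C (Lunit C (Unit C))"
    and Del_Unit: "Del C (Unit C) = Id C (Unit C)"

locale involutive_markov_category = icd_category C
  for C :: "('o, 'm, 'x) icd_data_scheme" (structure) +
  assumes Del_natural: "f \<in> hom C A B \<Longrightarrow> Del C B \<cdot> f = Del C A"

definition self_adjoint :: "('o, 'm, 'x) involutive_data_scheme \<Rightarrow> 'm \<Rightarrow> bool" where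
  "self_adjoint C f \<longleftrightarrow> Bar C f = f"

text \<open>The set of deterministic morphisms.\<close>

definition Det :: "('o, 'm, 'x) icd_data_scheme \<Rightarrow> 'm set" where
  "Det C = {f \<in> Arr C. self_adjoint C f \<and>
     Copy C (Cod C f) \<cdot>\<^bsub>C\<^esub> f = (f \<otimes>\<^bsub>C\<^esub> f) \<cdot>\<^bsub>C\<^esub> Copy C (Dom C f)}"

definition classical :: "('o, 'm, 'x) icd_data_scheme \<Rightarrow> 'o \<Rightarrow> bool" where
  "classical C A \<longleftrightarrow> A \<in> Obj C \<and> Swap C A A \<cdot>\<^bsub>C\<^esub> Copy C A = Copy C A"

definition pair :: "('o, 'm, 'x) icd_data_scheme \<Rightarrow> 'm \<Rightarrow> 'm \<Rightarrow> 'm" where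
  "pair C f g = (f \<otimes>\<^bsub>C\<^esub> g) \<cdot>\<^bsub>C\<^esub> Copy C (Dom C f)"

definition compatible :: "('o, 'm, 'x) icd_data_scheme \<Rightarrow> 'm \<Rightarrow> 'm \<Rightarrow> bool" where
  "compatible C f g \<longleftrightarrow> f \<in> Arr C \<and> g \<in> Arr C \<and> Dom C f = Dom C g \<and>
     pair C f g = Swap C (Cod C g) (Cod C f) \<cdot>\<^bsub>C\<^esub> pair C g f"

primrec pair_power :: "('o, 'm, 'x) icd_data_scheme \<Rightarrow> 'm \<Rightarrow> nat \<Rightarrow> 'm" where
  "pair_power C f 0 = Del C (Dom C f)"
| "pair_power C f (Suc n) = pair C (pair_power C f n) f"

section \<open>Pictures\<close>

text \<open>A wide subcategory is given by its set \<open>D\<close> of morphisms.\<close>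

locale picture = involutive_markov_category C
  for C :: "('o, 'm, 'x) icd_data_scheme" (structure) and D :: "'m set" +
  assumes D_Arr: "D \<subseteq> Arr C"
    and D_Id: "A \<in> Obj C \<Longrightarrow> Id C A \<in> D"
    and D_Comp: "f \<in> D \<Longrightarrow> g \<in> D \<Longrightarrow> Cod C f = Dom C g \<Longrightarrow> g \<cdot> f \<in> D"
    and D_TensorM: "f \<in> D \<Longrightarrow> g \<in> D \<Longrightarrow> f \<otimes> g \<in> D"
    and D_Assoc: "A \<in> Obj C \<Longrightarrow> B \<in> Obj C \<Longrightarrow> E \<in> Obj C \<Longrightarrow>
          Assoc C A B E \<in> D \<and> inv_arr C (Assoc C A B E) \<in> D"
    and D_Lunit: "A \<in> Obj C \<Longrightarrow> Lunit C A \<in> D \<and> inv_arr C (Lunit C A) \<in> D"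
    and D_Runit: "A \<in> Obj C \<Longrightarrow> Runit C A \<in> D \<and> inv_arr C (Runit C A) \<in> D"
    and D_Swap: "A \<in> Obj C \<Longrightarrow> B \<in> Obj C \<Longrightarrow> Swap C A B \<in> D"
    and D_Del: "A \<in> Obj C \<Longrightarrow> Del C A \<in> D"
    and D_self_adjoint: "f \<in> D \<Longrightarrow> self_adjoint C f"
    and D_pair: "f \<in> D \<Longrightarrow> g \<in> D \<Longrightarrow> compatible C f g \<Longrightarrow> compatible C f f \<Longrightarrow> pair C f g \<in> D"

section \<open>Finite tensor products of a family\<close>

text \<open>Lists of indices are read from right to left: the head is the index of the rightmost tensor
  factor, and \<open>tensor_list C A [j\<^sub>n, \<dots>, j\<^sub>1]\<close> is \<open>((I \<odot> A j\<^sub>1) \<odot> \<dots>) \<odot> A j\<^sub>n\<close>. This is the bracketing of the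
  codomain of \<open>pair_power\<close>.\<close>

primrec tensor_list :: "('o, 'm, 'x) monoidal_data_scheme \<Rightarrow> (nat \<Rightarrow> 'o) \<Rightarrow> nat list \<Rightarrow> 'o" where
  "tensor_list C A [] = Unit C"
| "tensor_list C A (j # js) = tensor_list C A js \<odot>\<^bsub>C\<^esub> A j"

definition desc_list :: "nat set \<Rightarrow> nat list" where
  "desc_list F = rev (sorted_list_of_set F)"

definition tensor_set :: "('o, 'm, 'x) monoidal_data_scheme \<Rightarrow> (nat \<Rightarrow> 'o) \<Rightarrow> nat set \<Rightarrow> 'o" where
  "tensor_set C A F = tensor_list C A (desc_list F)"

primrec proj_list :: "('o, 'm, 'x) icd_data_scheme \<Rightarrow> (nat \<Rightarrow> 'o) \<Rightarrow> nat set \<Rightarrow> nat list \<Rightarrow> 'm" where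
  "proj_list C A F' [] = Id C (Unit C)"
| "proj_list C A F' (j # js) =
     (if j \<in> F' then proj_list C A F' js \<otimes>\<^bsub>C\<^esub> Id C (A j)
      else Runit C (tensor_list C A (filter (\<lambda>i. i \<in> F') js)) \<cdot>\<^bsub>C\<^esub> (proj_list C A F' js \<otimes>\<^bsub>C\<^esub> Del C (A j)))"

text \<open>\<open>\<pi>\<^bsub>F,F'\<^esub>\<close>, for \<open>F' \<subseteq> F\<close>.\<close>

definition fin_proj :: "('o, 'm, 'x) icd_data_scheme \<Rightarrow> (nat \<Rightarrow> 'o) \<Rightarrow> nat set \<Rightarrow> nat set \<Rightarrow> 'm" where
  "fin_proj C A F F' = proj_list C A F' (desc_list F)"

text \<open>For distinct lists \<open>js\<close> with \<open>j\<close> in \<open>js\<close>, \<open>move_last C A j js\<close> is the symmetry that moves the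
  factor \<open>j\<close> to the rightmost position,
  from \<open>tensor_list C A js\<close> to \<open>tensor_list C A (remove1 j js) \<odot> A j\<close>. If \<open>ks\<close> is a permutation of
  \<open>js\<close>, then \<open>reorder C A js ks\<close> is the symmetry from \<open>tensor_list C A js\<close> to \<open>tensor_list C A ks\<close>
  matching equally labelled factors.\<close>

primrec move_last :: "('o, 'm, 'x) monoidal_data_scheme \<Rightarrow> (nat \<Rightarrow> 'o) \<Rightarrow> nat \<Rightarrow> nat list \<Rightarrow> 'm" where
  "move_last C A j [] = undefined"
| "move_last C A j (k # js) =
     (if k = j then Id C (tensor_list C A (k # js))
      else (let T = tensor_list C A (remove1 j js) in
        inv_arr C (Assoc C T (A k) (A j)) \<cdot>\<^bsub>C\<^esub> (Id C T \<otimes>\<^bsub>C\<^esub> Swap C (A j) (A k)) \<cdot>\<^bsub>C\<^esub>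
        Assoc C T (A j) (A k) \<cdot>\<^bsub>C\<^esub> (move_last C A j js \<otimes>\<^bsub>C\<^esub> Id C (A k))))"

fun reorder :: "('o, 'm, 'x) monoidal_data_scheme \<Rightarrow> (nat \<Rightarrow> 'o) \<Rightarrow> nat list \<Rightarrow> nat list \<Rightarrow> 'm" where
  "reorder C A js [] = Id C (Unit C)"
| "reorder C A js (k # ks) = (reorder C A (remove1 k js) ks \<otimes>\<^bsub>C\<^esub> Id C (A k)) \<cdot>\<^bsub>C\<^esub> move_last C A k js"

text \<open>\<open>A\<^bsub>\<sigma>|F\<^esub>\<close> for a constant family \<open>A\<close>: in the tensor product over \<open>\<sigma> ` F\<close>, the factor labelled \<open>\<sigma> j\<close>
  is given the label \<open>j\<close>, and the factors are then put in the order of \<open>F\<close>. The relabelling does not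
  change the object because the family is constant.\<close>

definition fin_perm :: "('o, 'm, 'x) monoidal_data_scheme \<Rightarrow> 'o \<Rightarrow> (nat \<Rightarrow> nat) \<Rightarrow> nat set \<Rightarrow> 'm" where
  "fin_perm C A \<sigma> F = reorder C (\<lambda>_. A) (map (inv \<sigma>) (desc_list (\<sigma> ` F))) (desc_list F)"

section \<open>Kolmogorov products\<close>

text \<open>\<open>families C X J A B E\<close> are the families \<open>(\<phi>\<^sub>F : B \<rightarrow> A\<^sub>F \<odot> E)\<close>, over the finite subsets \<open>F\<close> of \<open>J\<close>,
  of morphisms in \<open>X\<close> that are compatible with the projections.\<close>

definition families :: "('o, 'm, 'x) icd_data_scheme \<Rightarrow> 'm set \<Rightarrow> nat set \<Rightarrow> (nat \<Rightarrow> 'o) \<Rightarrow> 'o \<Rightarrow> 'o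
    \<Rightarrow> (nat set \<Rightarrow> 'm) set" where
  "families C X J A B E =
     {\<phi> \<in> (\<Pi>\<^sub>E F \<in> Fpow J. hom C B (tensor_set C A F \<odot>\<^bsub>C\<^esub> E) \<inter> X).
        \<forall>F \<in> Fpow J. \<forall>F' \<subseteq> F. (fin_proj C A F F' \<otimes>\<^bsub>C\<^esub> Id C E) \<cdot>\<^bsub>C\<^esub> \<phi> F = \<phi> F'}"

text \<open>A Kolmogorov product of \<open>(A\<^sub>j)\<^bsub>j \<in> J\<^esub>\<close> is an object \<open>K\<close> together with bijections \<open>\<Phi> B E\<close>, natural in
  \<open>B\<close> and \<open>E\<close>. Naturality of the restrictions of \<open>\<Phi>\<close> to \<open>D\<close> and to \<open>Det C\<close> is automatic.\<close>

definition kolmogorov_product :: "('o, 'm, 'x) icd_data_scheme \<Rightarrow> 'm set \<Rightarrow> nat set \<Rightarrow> (nat \<Rightarrow> 'o)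
    \<Rightarrow> 'o \<Rightarrow> ('o \<Rightarrow> 'o \<Rightarrow> 'm \<Rightarrow> nat set \<Rightarrow> 'm) \<Rightarrow> bool" where
  "kolmogorov_product C D J A K \<Phi> \<longleftrightarrow>
     K \<in> Obj C \<and>
     (\<forall>B \<in> Obj C. \<forall>E \<in> Obj C. \<forall>X \<in> {Arr C, D, Det C}.
        bij_betw (\<Phi> B E) (hom C B (K \<odot>\<^bsub>C\<^esub> E) \<inter> X) (families C X J A B E)) \<and>
     (\<forall>B \<in> Obj C. \<forall>B' \<in> Obj C. \<forall>E \<in> Obj C. \<forall>b \<in> hom C B' B. \<forall>\<phi> \<in> hom C B (K \<odot>\<^bsub>C\<^esub> E). \<forall>F \<in> Fpow J.
        \<Phi> B' E (\<phi> \<cdot>\<^bsub>C\<^esub> b) F = \<Phi> B E \<phi> F \<cdot>\<^bsub>C\<^esub> b) \<and>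
     (\<forall>B \<in> Obj C. \<forall>E \<in> Obj C. \<forall>E' \<in> Obj C. \<forall>e \<in> hom C E E'. \<forall>\<phi> \<in> hom C B (K \<odot>\<^bsub>C\<^esub> E). \<forall>F \<in> Fpow J.
        \<Phi> B E' ((Id C K \<otimes>\<^bsub>C\<^esub> e) \<cdot>\<^bsub>C\<^esub> \<phi>) F = (Id C (tensor_set C A F) \<otimes>\<^bsub>C\<^esub> e) \<cdot>\<^bsub>C\<^esub> \<Phi> B E \<phi> F)"

text \<open>The marginalizations are the universal family: the image of \<open>id\<^sub>K\<close> for \<open>E = I\<close>, up to unitors.\<close>

definition marginal :: "('o, 'm, 'x) icd_data_scheme \<Rightarrow> (nat \<Rightarrow> 'o) \<Rightarrow> 'o
    \<Rightarrow> ('o \<Rightarrow> 'o \<Rightarrow> 'm \<Rightarrow> nat set \<Rightarrow> 'm) \<Rightarrow> nat set \<Rightarrow> 'm" where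
  "marginal C A K \<Phi> F =
     Runit C (tensor_set C A F) \<cdot>\<^bsub>C\<^esub> \<Phi> K (Unit C) (inv_arr C (Runit C K)) F"

text \<open>Every countable index set is in bijection with a set of natural numbers, so it suffices to
  consider families indexed by the latter.\<close>

definition has_countable_kolmogorov_products :: "('o, 'm, 'x) icd_data_scheme \<Rightarrow> 'm set \<Rightarrow> bool" where
  "has_countable_kolmogorov_products C D \<longleftrightarrow>
     (\<forall>(J :: nat set) A. A ` J \<subseteq> Obj C \<longrightarrow> (\<exists>K \<Phi>. kolmogorov_product C D J A K \<Phi>))"

text \<open>In the following two definitions, \<open>(K, \<Phi>)\<close> is a Kolmogorov product \<open>A\<^sub>\<nat>\<close> of the constant family.\<close>

definition inf_power :: "('o, 'm, 'x) icd_data_scheme \<Rightarrow> 'o \<Rightarrow> 'o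
    \<Rightarrow> ('o \<Rightarrow> 'o \<Rightarrow> 'm \<Rightarrow> nat set \<Rightarrow> 'm) \<Rightarrow> 'm \<Rightarrow> 'm" where
  "inf_power C A K \<Phi> f =
     (THE g. g \<in> hom C (Dom C f) K \<and>
        (\<forall>F. finite F \<longrightarrow> marginal C (\<lambda>_. A) K \<Phi> F \<cdot>\<^bsub>C\<^esub> g = pair_power C f (card F)))"

definition inf_perm :: "('o, 'm, 'x) icd_data_scheme \<Rightarrow> 'o \<Rightarrow> 'o
    \<Rightarrow> ('o \<Rightarrow> 'o \<Rightarrow> 'm \<Rightarrow> nat set \<Rightarrow> 'm) \<Rightarrow> (nat \<Rightarrow> nat) \<Rightarrow> 'm" where
  "inf_perm C A K \<Phi> \<sigma> =
     (THE g. g \<in> hom C K K \<and>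
        (\<forall>F. finite F \<longrightarrow> marginal C (\<lambda>_. A) K \<Phi> F \<cdot>\<^bsub>C\<^esub> g =
           fin_perm C A \<sigma> F \<cdot>\<^bsub>C\<^esub> marginal C (\<lambda>_. A) K \<Phi> (\<sigma> ` F)))"

section \<open>De Finetti objects and state space objects\<close>

text \<open>\<open>e : Q \<rightarrow> K\<close> is the equalizer, in the wide subcategory \<open>D\<close>, of the set \<open>S\<close> of parallel morphisms
  \<open>K \<rightarrow> L\<close>.\<close>

definition is_equalizer :: "('o, 'm, 'x) category_data_scheme \<Rightarrow> 'm set \<Rightarrow> 'o \<Rightarrow> 'o \<Rightarrow> 'o \<Rightarrow> 'm set \<Rightarrow> 'm
    \<Rightarrow> bool" where
  "is_equalizer C D Q K L S e \<longleftrightarrow>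
     S \<subseteq> hom C K L \<inter> D \<and> e \<in> hom C Q K \<inter> D \<and>
     (\<forall>s \<in> S. \<forall>t \<in> S. s \<cdot>\<^bsub>C\<^esub> e = t \<cdot>\<^bsub>C\<^esub> e) \<and>
     (\<forall>B \<in> Obj C. \<forall>f \<in> hom C B K \<inter> D. (\<forall>s \<in> S. \<forall>t \<in> S. s \<cdot>\<^bsub>C\<^esub> f = t \<cdot>\<^bsub>C\<^esub> f) \<longrightarrow>
        (\<exists>!g. g \<in> hom C B Q \<inter> D \<and> e \<cdot>\<^bsub>C\<^esub> g = f))"

definition monic :: "('o, 'm, 'x) category_data_scheme \<Rightarrow> 'm \<Rightarrow> bool" where
  "monic C m \<longleftrightarrow> m \<in> Arr C \<and>
     (\<forall>B \<in> Obj C. \<forall>f \<in> hom C B (Dom C m). \<forall>g \<in> hom C B (Dom C m). m \<cdot>\<^bsub>C\<^esub> f = m \<cdot>\<^bsub>C\<^esub> g \<longrightarrow> f = g)"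

text \<open>\<open>K\<close> is \<open>A\<^sub>\<nat>\<close>. Kolmogorov products are unique up to isomorphism, so its choice does not matter.\<close>

definition de_finetti_object :: "('o, 'm, 'x) icd_data_scheme \<Rightarrow> 'm set \<Rightarrow> 'o \<Rightarrow> 'o \<Rightarrow> 'm \<Rightarrow> bool" where
  "de_finetti_object C D A Q l \<longleftrightarrow>
     Q \<in> Obj C \<and> l \<in> hom C Q A \<inter> D \<and> compatible C l l \<and>
     (\<exists>K \<Phi>. kolmogorov_product C D UNIV (\<lambda>_. A) K \<Phi> \<and>
        (let S = inf_perm C A K \<Phi> ` {\<sigma>. bij \<sigma> \<and> finite {n. \<sigma> n \<noteq> n}}; e = inf_power C A K \<Phi> l in
          is_equalizer C D Q K K S e \<and>
          (\<forall>B \<in> Obj C. is_equalizer C D (Q \<odot>\<^bsub>C\<^esub> B) (K \<odot>\<^bsub>C\<^esub> B) (K \<odot>\<^bsub>C\<^esub> B)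
             ((\<lambda>s. s \<otimes>\<^bsub>C\<^esub> Id C B) ` S) (e \<otimes>\<^bsub>C\<^esub> Id C B)) \<and>
          (\<forall>B \<in> Obj C. monic C (e \<otimes>\<^bsub>C\<^esub> Id C B))))"

definition state_space_object :: "('o, 'm, 'x) icd_data_scheme \<Rightarrow> 'm set \<Rightarrow> 'o \<Rightarrow> 'o \<Rightarrow> 'm \<Rightarrow> bool" where
  "state_space_object C D A S ev \<longleftrightarrow>
     classical C S \<and> ev \<in> hom C S A \<inter> D \<and>
     (\<forall>B. classical C B \<longrightarrow>
        bij_betw (\<lambda>f. ev \<cdot>\<^bsub>C\<^esub> f) (hom C B S \<inter> (D \<inter> Det C)) (hom C B A \<inter> D))"

end

theory Submission
  imports Defs
begin

text \<open>Why the theorem holds. Let \<open>K\<close> be the Kolmogorov product of countably many copies of \<open>A\<close> and let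
  \<open>e = l\<^sup>(\<^sup>\<nat>\<^sup>) : QA \<rightarrow> K\<close>. The marginal of \<open>e\<close> on \<open>n\<close> factors is the power \<open>l\<^sup>(\<^sup>n\<^sup>)\<close>, so an equation between
  morphisms into \<open>K \<odot> K\<close> that factor through \<open>e \<odot> e\<close> can be tested on the pairs
  \<open>(l\<^sup>(\<^sup>m\<^sup>), l\<^sup>(\<^sup>n\<^sup>))\<close>; and since \<open>e \<odot> id\<close> is monic, it can then be cancelled to an equation between
  morphisms into \<open>QA \<odot> QA\<close> (\<open>eq_if_powers_eq\<close>). Three consequences make up the proof.

  \<^item> \<open>QA\<close> is classical: the powers of an autocompatible morphism are compatible with each other, which
    is symmetry of \<open>copy\<close> after composition with \<open>l\<^sup>(\<^sup>m\<^sup>) \<odot> l\<^sup>(\<^sup>n\<^sup>)\<close>.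

  \<^item> A morphism \<open>f : B \<rightarrow> A\<close> with \<open>B\<close> classical is autocompatible, so its powers lie in the picture and
    \<open>f\<^sup>(\<^sup>\<nat>\<^sup>)\<close> is invariant under finite permutations. The equalizer property gives \<open>g\<close> with
    \<open>e g = f\<^sup>(\<^sup>\<nat>\<^sup>)\<close>. It satisfies \<open>l\<^sup>(\<^sup>n\<^sup>) g = f\<^sup>(\<^sup>n\<^sup>)\<close> for all \<open>n\<close>. Splitting \<open>n\<close> as a sum shows that \<open>copy g\<close> and
    \<open>(g, g)\<close> both become \<open>(f\<^sup>(\<^sup>m\<^sup>), f\<^sup>(\<^sup>n\<^sup>))\<close>, so \<open>g\<close> is deterministic; the case \<open>n = 1\<close> says \<open>l g = f\<close>.

  \<^item> If \<open>g\<close> is deterministic, then \<open>e g = (l g)\<^sup>(\<^sup>\<nat>\<^sup>)\<close>, so \<open>l g\<close> determines \<open>g\<close> because \<open>e\<close> is monic.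

  Two points need real work. First, testing on marginals in the presence of a further tensor factor:
  one needs that the morphisms \<open>\<pi>\<^sub>F \<odot> id\<^sub>E\<close> are jointly monic on \<open>K \<odot> E\<close>, whereas the universal property
  speaks about a family \<open>u\<^sub>E\<^sub>,\<^sub>F : K \<odot> E \<rightarrow> A\<^sub>F \<odot> E\<close> that is merely natural in \<open>E\<close>. Naturality does not force
  \<open>u\<^sub>E\<^sub>,\<^sub>F = \<pi>\<^sub>F \<odot> id\<^sub>E\<close>: for instance, in a category of objects with an action of an abelian group, the
  bijections can be composed with the action of a group element on \<open>E\<close>. The comparison between the two
  families is shown to be split monic (\<open>twist_split_monic\<close>). Second, the permutation \<open>A\<^sub>\<sigma>\<close> of \<open>K\<close>
  exists only because permutations of finitely many factors commute with deleting factors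
  (\<open>reorder_proj\<close>), a coherence statement proved by induction along the recursion that defines them.\<close>

section \<open>Composition as a partial algebra\<close>

text \<open>Typing is expressed by \<open>Arr\<close>, \<open>Dom\<close> and \<open>Cod\<close> instead of hom-sets: no intermediate objects have to
  be guessed, so rewriting can decide whether composites are defined. Composites are normalized by
  nesting them to the right.\<close>

context category
begin

lemma in_homI: "f \<in> Arr C \<Longrightarrow> Dom C f = A \<Longrightarrow> Cod C f = B \<Longrightarrow> f \<in> hom C A B"
  by (simp add: hom_def)

lemma in_hom: "f \<in> Arr C \<Longrightarrow> f \<in> hom C (Dom C f) (Cod C f)"
  by (simp add: hom_def)

lemma Dom_Cod_Obj [simp]:
  assumes "f \<in> Arr C"
  shows "Dom C f \<in> Obj C" "Cod C f \<in> Obj C"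
  using assms by (auto intro: Dom_Obj Cod_Obj)

lemma Id_arr [simp]:
  assumes "A \<in> Obj C"
  shows "Id C A \<in> Arr C" "Dom C (Id C A) = A" "Cod C (Id C A) = A"
  using Id_hom[OF assms] by (auto simp: hom_def)

lemma comp_arr [simp]:
  assumes "f \<in> Arr C" "g \<in> Arr C" "Cod C f = Dom C g"
  shows "g \<cdot> f \<in> Arr C" "Dom C (g \<cdot> f) = Dom C f" "Cod C (g \<cdot> f) = Cod C g"
  using Comp_hom[of f "Dom C f" "Dom C g" g "Cod C g"] assms by (auto simp: hom_def)

lemma comp_Id [simp]:
  assumes "f \<in> Arr C"
  shows "Cod C f = B \<Longrightarrow> Id C B \<cdot> f = f" "Dom C f = A \<Longrightarrow> f \<cdot> Id C A = f"
  using Id_left Id_right in_hom[OF assms] by auto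

lemma comp_assoc [simp]:
  assumes "f \<in> Arr C" "g \<in> Arr C" "h \<in> Arr C" "Cod C f = Dom C g" "Cod C g = Dom C h"
  shows "(h \<cdot> g) \<cdot> f = h \<cdot> (g \<cdot> f)"
  using Comp_assoc[of f "Dom C f" "Dom C g" g "Dom C h" h "Cod C h"] assms by (auto simp: hom_def)

text \<open>Applies an equation to the first two morphisms of a longer composite in right-nested form.\<close>

lemma comp_ext:
  assumes "a \<cdot> b = c" "a \<in> Arr C" "b \<in> Arr C" "x \<in> Arr C" "Cod C b = Dom C a" "Cod C x = Dom C b"
  shows "a \<cdot> (b \<cdot> x) = c \<cdot> x"
  using comp_assoc[of x b a] assms by simp

lemma inverse_arrows_unique:
  assumes "inverse_arrows C f g" "inverse_arrows C f h"
  shows "g = h"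
proof -
  have "g = g \<cdot> (f \<cdot> h)" using assms by (auto simp: inverse_arrows_def hom_def)
  also have "\<dots> = (g \<cdot> f) \<cdot> h" using assms by (subst comp_assoc) (auto simp: inverse_arrows_def hom_def)
  also have "\<dots> = h" using assms by (auto simp: inverse_arrows_def hom_def)
  finally show ?thesis .
qed

lemma inverse_arrows_inv_arr: "is_iso C f \<Longrightarrow> inverse_arrows C f (inv_arr C f)"
  unfolding is_iso_def inv_arr_def using inverse_arrows_unique by (metis theI)

lemma inv_arr [simp]:
  assumes "is_iso C f"
  shows "inv_arr C f \<in> Arr C" "Dom C (inv_arr C f) = Cod C f" "Cod C (inv_arr C f) = Dom C f"
    "inv_arr C f \<cdot> f = Id C (Dom C f)" "f \<cdot> inv_arr C f = Id C (Cod C f)"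
  using inverse_arrows_inv_arr[OF assms] by (auto simp: inverse_arrows_def hom_def)

lemma iso_arr: "is_iso C f \<Longrightarrow> f \<in> Arr C"
  by (auto simp: is_iso_def inverse_arrows_def)

lemma inv_arr_cancel [simp]:
  assumes "is_iso C f" "x \<in> Arr C"
  shows "Cod C x = Dom C f \<Longrightarrow> inv_arr C f \<cdot> (f \<cdot> x) = x"
    "Cod C x = Cod C f \<Longrightarrow> f \<cdot> (inv_arr C f \<cdot> x) = x"
  using assms iso_arr[OF assms(1)] by (simp_all add: comp_ext)

lemma iso_cancel_left:
  assumes "f \<cdot> x = f \<cdot> y" "is_iso C f" "x \<in> Arr C" "y \<in> Arr C" "Cod C x = Dom C f" "Cod C y = Dom C f"
  shows "x = y"
  by (metis assms inv_arr_cancel(1))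

lemma iso_cancel_right:
  assumes "x \<cdot> f = y \<cdot> f" "is_iso C f" "x \<in> Arr C" "y \<in> Arr C" "Dom C x = Cod C f" "Dom C y = Cod C f"
  shows "x = y"
proof -
  have "(x \<cdot> f) \<cdot> inv_arr C f = (y \<cdot> f) \<cdot> inv_arr C f" using assms(1) by simp
  then show ?thesis using assms(2-) iso_arr[OF assms(2)] by simp
qed

end

section \<open>Coherence of the unitors and the symmetry\<close>

context symmetric_monoidal_category
begin

lemmas objects [simp] = Unit_Obj TensorO_Obj
lemmas isos [simp] = Assoc_iso Lunit_iso Runit_iso

lemma tensor_arr [simp]:
  assumes "f \<in> Arr C" "g \<in> Arr C"
  shows "f \<otimes> g \<in> Arr C" "Dom C (f \<otimes> g) = Dom C f \<odot> Dom C g" "Cod C (f \<otimes> g) = Cod C f \<odot> Cod C g"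
  using TensorM_hom[OF in_hom[OF assms(1)] in_hom[OF assms(2)]] by (auto simp: hom_def)

lemma Assoc_arr [simp]:
  assumes "A \<in> Obj C" "B \<in> Obj C" "E \<in> Obj C"
  shows "Assoc C A B E \<in> Arr C" "Dom C (Assoc C A B E) = (A \<odot> B) \<odot> E"
    "Cod C (Assoc C A B E) = A \<odot> (B \<odot> E)"
  using Assoc_hom[OF assms] by (auto simp: hom_def)

lemma unitor_arr [simp]:
  assumes "A \<in> Obj C"
  shows "Lunit C A \<in> Arr C" "Dom C (Lunit C A) = Unit C \<odot> A" "Cod C (Lunit C A) = A"
    "Runit C A \<in> Arr C" "Dom C (Runit C A) = A \<odot> Unit C" "Cod C (Runit C A) = A"
  using Lunit_hom[OF assms] Runit_hom[OF assms] by (auto simp: hom_def)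

lemma Swap_arr [simp]:
  assumes "A \<in> Obj C" "B \<in> Obj C"
  shows "Swap C A B \<in> Arr C" "Dom C (Swap C A B) = A \<odot> B" "Cod C (Swap C A B) = B \<odot> A"
  using Swap_hom[OF assms] by (auto simp: hom_def)

lemmas tensor_Id [simp] = TensorM_Id

lemma interchange [simp]:
  assumes "f \<in> Arr C" "f' \<in> Arr C" "g \<in> Arr C" "g' \<in> Arr C" "Cod C f = Dom C f'" "Cod C g = Dom C g'"
  shows "(f' \<otimes> g') \<cdot> (f \<otimes> g) = (f' \<cdot> f) \<otimes> (g' \<cdot> g)"
  using TensorM_Comp[of f "Dom C f" "Dom C f'" f' "Cod C f'" g "Dom C g" "Dom C g'" g' "Cod C g'"] assms
  by (auto simp: hom_def)

lemma interchange_ext [simp]: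
  assumes "f \<in> Arr C" "f' \<in> Arr C" "g \<in> Arr C" "g' \<in> Arr C" "Cod C f = Dom C f'" "Cod C g = Dom C g'"
    "x \<in> Arr C" "Cod C x = Dom C f \<odot> Dom C g"
  shows "(f' \<otimes> g') \<cdot> ((f \<otimes> g) \<cdot> x) = ((f' \<cdot> f) \<otimes> (g' \<cdot> g)) \<cdot> x"
  using assms by (intro comp_ext interchange) auto

lemma Assoc_nat:
  assumes "f \<in> Arr C" "g \<in> Arr C" "h \<in> Arr C"
  shows "Assoc C (Cod C f) (Cod C g) (Cod C h) \<cdot> ((f \<otimes> g) \<otimes> h) =
    (f \<otimes> (g \<otimes> h)) \<cdot> Assoc C (Dom C f) (Dom C g) (Dom C h)"
  using Assoc_natural[OF in_hom in_hom in_hom] assms by blast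

lemma Assoc_inv_nat:
  assumes "f \<in> Arr C" "g \<in> Arr C" "h \<in> Arr C"
  shows "inv_arr C (Assoc C (Cod C f) (Cod C g) (Cod C h)) \<cdot> (f \<otimes> (g \<otimes> h)) =
    ((f \<otimes> g) \<otimes> h) \<cdot> inv_arr C (Assoc C (Dom C f) (Dom C g) (Dom C h))"
    (is "inv_arr C ?a' \<cdot> ?F = ?G \<cdot> inv_arr C ?a")
proof (rule iso_cancel_left)
  show "is_iso C ?a'" using assms by simp
  have "?a' \<cdot> (?G \<cdot> inv_arr C ?a) = (?a' \<cdot> ?G) \<cdot> inv_arr C ?a" using assms by simp
  also have "\<dots> = ?F" using assms by (simp add: Assoc_nat)
  finally show "?a' \<cdot> (inv_arr C ?a' \<cdot> ?F) = ?a' \<cdot> (?G \<cdot> inv_arr C ?a)" using assms by simp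
qed (use assms in auto)

lemma Swap_nat:
  assumes "f \<in> Arr C" "g \<in> Arr C"
  shows "Swap C (Cod C f) (Cod C g) \<cdot> (f \<otimes> g) = (g \<otimes> f) \<cdot> Swap C (Dom C f) (Dom C g)"
  using Swap_natural[OF in_hom in_hom] assms by blast

lemma Lunit_nat: "f \<in> Arr C \<Longrightarrow> Lunit C (Cod C f) \<cdot> (Id C (Unit C) \<otimes> f) = f \<cdot> Lunit C (Dom C f)"
  using Lunit_natural[OF in_hom] by blast

lemma Runit_nat: "f \<in> Arr C \<Longrightarrow> Runit C (Cod C f) \<cdot> (f \<otimes> Id C (Unit C)) = f \<cdot> Runit C (Dom C f)"
  using Runit_natural[OF in_hom] by blast

lemma Runit_inv_nat:
  assumes "f \<in> Arr C"
  shows "inv_arr C (Runit C (Cod C f)) \<cdot> f = (f \<otimes> Id C (Unit C)) \<cdot> inv_arr C (Runit C (Dom C f))"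
proof (rule iso_cancel_left)
  show "is_iso C (Runit C (Cod C f))" using assms by simp
  show "Runit C (Cod C f) \<cdot> inv_arr C (Runit C (Cod C f)) \<cdot> f =
      Runit C (Cod C f) \<cdot> ((f \<otimes> Id C (Unit C)) \<cdot> inv_arr C (Runit C (Dom C f)))"
    using assms comp_ext[OF Runit_nat[OF assms], of "inv_arr C (Runit C (Dom C f))"] by simp
qed (use assms in auto)

lemma iso_Swap [simp]: "A \<in> Obj C \<Longrightarrow> B \<in> Obj C \<Longrightarrow> is_iso C (Swap C A B)"
  unfolding is_iso_def inverse_arrows_def
  by (rule exI[of _ "Swap C B A"]) (simp add: in_homI Swap_Swap)

lemma iso_tensor [simp]:
  assumes "is_iso C f" "is_iso C g"
  shows "is_iso C (f \<otimes> g)"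
  unfolding is_iso_def inverse_arrows_def
  by (rule exI[of _ "inv_arr C f \<otimes> inv_arr C g"]) (use assms iso_arr in \<open>simp add: in_homI\<close>)

lemma iso_Id [simp]: "A \<in> Obj C \<Longrightarrow> is_iso C (Id C A)"
  unfolding is_iso_def inverse_arrows_def
  by (rule exI[of _ "Id C A"]) (simp add: in_homI)

lemma iso_comp [simp]:
  assumes "is_iso C f" "is_iso C g" "Cod C f = Dom C g"
  shows "is_iso C (g \<cdot> f)"
  unfolding is_iso_def inverse_arrows_def
  by (rule exI[of _ "inv_arr C f \<cdot> inv_arr C g"])
    (use assms iso_arr[OF assms(1)] iso_arr[OF assms(2)] in \<open>simp add: in_homI\<close>)

text \<open>Coherence laws are proved below after tensoring with the unit object, where the pentagon and the
  triangle become applicable.\<close>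

lemma Unit_tensor_faithful:
  assumes "f \<in> Arr C" "g \<in> Arr C" "Dom C f = Dom C g" "Cod C f = Cod C g"
    "Id C (Unit C) \<otimes> f = Id C (Unit C) \<otimes> g"
  shows "f = g"
  by (rule iso_cancel_right[where f = "Lunit C (Dom C f)"])
    (use assms Lunit_nat[of f] Lunit_nat[of g] in auto)

lemma tensor_Unit_faithful:
  assumes "f \<in> Arr C" "g \<in> Arr C" "Dom C f = Dom C g" "Cod C f = Cod C g"
    "f \<otimes> Id C (Unit C) = g \<otimes> Id C (Unit C)"
  shows "f = g"
  by (rule iso_cancel_right[where f = "Runit C (Dom C f)"])
    (use assms Runit_nat[of f] Runit_nat[of g] in auto)

text \<open>Kelly's derivation: after tensoring with the unit object, the law follows from the pentagon for
  \<open>I, I, A, B\<close> and two triangles.\<close>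

lemma Lunit_tensor:
  assumes A: "A \<in> Obj C" and B: "B \<in> Obj C"
  shows "Lunit C (A \<odot> B) \<cdot> Assoc C (Unit C) A B = Lunit C A \<otimes> Id C B"
proof (rule Unit_tensor_faithful)
  let ?I = "Unit C"
  let ?b = "Assoc C ?I (?I \<odot> A) B \<cdot> (Assoc C ?I ?I A \<otimes> Id C B)"
  have "(Id C ?I \<otimes> (Lunit C (A \<odot> B) \<cdot> Assoc C ?I A B)) \<cdot> ?b =
      (Id C ?I \<otimes> Lunit C (A \<odot> B)) \<cdot> ((Id C ?I \<otimes> Assoc C ?I A B) \<cdot> ?b)"
    using A B by simp
  also have "\<dots> = (Id C ?I \<otimes> Lunit C (A \<odot> B)) \<cdot> (Assoc C ?I ?I (A \<odot> B) \<cdot> Assoc C (?I \<odot> ?I) A B)"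
    using A B by (simp only: pentagon Unit_Obj)
  also have "\<dots> = (Runit C ?I \<otimes> (Id C A \<otimes> Id C B)) \<cdot> Assoc C (?I \<odot> ?I) A B"
    using A B triangle[of ?I "A \<odot> B"] by (subst comp_ext[OF triangle]) auto
  also have "\<dots> = Assoc C ?I A B \<cdot> ((Runit C ?I \<otimes> Id C A) \<otimes> Id C B)"
    using A B Assoc_nat[of "Runit C ?I" "Id C A" "Id C B"] by simp
  also have "\<dots> = Assoc C ?I A B \<cdot> (((Id C ?I \<otimes> Lunit C A) \<otimes> Id C B) \<cdot> (Assoc C ?I ?I A \<otimes> Id C B))"
    using A B by (simp add: triangle)
  also have "\<dots> = (Id C ?I \<otimes> (Lunit C A \<otimes> Id C B)) \<cdot> ?b"
    using A B Assoc_nat[of "Id C ?I" "Lunit C A" "Id C B"]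
      comp_ext[OF Assoc_nat[of "Id C ?I" "Lunit C A" "Id C B"], of "Assoc C ?I ?I A \<otimes> Id C B"]
    by (simp del: interchange interchange_ext)
  finally show "Id C ?I \<otimes> (Lunit C (A \<odot> B) \<cdot> Assoc C ?I A B) = Id C ?I \<otimes> (Lunit C A \<otimes> Id C B)"
    by (rule iso_cancel_right) (use A B in auto)
qed (use A B in auto)

text \<open>The mirror image of the previous law, from the pentagon for \<open>A, B, I, I\<close>.\<close>

lemma Runit_tensor:
  assumes A: "A \<in> Obj C" and B: "B \<in> Obj C"
  shows "(Id C A \<otimes> Runit C B) \<cdot> Assoc C A B (Unit C) = Runit C (A \<odot> B)"
proof (rule tensor_Unit_faithful)
  let ?I = "Unit C"
  let ?a = "Assoc C A B ?I"
  have "?a \<cdot> (((Id C A \<otimes> Runit C B) \<cdot> ?a) \<otimes> Id C ?I) =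
      (?a \<cdot> ((Id C A \<otimes> Runit C B) \<otimes> Id C ?I)) \<cdot> (?a \<otimes> Id C ?I)"
    using A B by simp
  also have "\<dots> = ((Id C A \<otimes> (Runit C B \<otimes> Id C ?I)) \<cdot> Assoc C A (B \<odot> ?I) ?I) \<cdot> (?a \<otimes> Id C ?I)"
    using A B Assoc_nat[of "Id C A" "Runit C B" "Id C ?I"] by simp
  also have "\<dots> = (Id C A \<otimes> (Id C B \<otimes> Lunit C ?I)) \<cdot>
      ((Id C A \<otimes> Assoc C B ?I ?I) \<cdot> (Assoc C A (B \<odot> ?I) ?I \<cdot> (?a \<otimes> Id C ?I)))"
    using A B by (simp add: triangle)
  also have "\<dots> = (Id C A \<otimes> (Id C B \<otimes> Lunit C ?I)) \<cdot> (Assoc C A B (?I \<odot> ?I) \<cdot> Assoc C (A \<odot> B) ?I ?I)"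
    using A B by (simp only: pentagon Unit_Obj)
  also have "\<dots> = ?a \<cdot> ((Id C (A \<odot> B) \<otimes> Lunit C ?I) \<cdot> Assoc C (A \<odot> B) ?I ?I)"
    using A B Assoc_nat[of "Id C A" "Id C B" "Lunit C ?I"]
      comp_ext[OF Assoc_nat[of "Id C A" "Id C B" "Lunit C ?I"], of "Assoc C (A \<odot> B) ?I ?I"] by simp
  also have "\<dots> = ?a \<cdot> (Runit C (A \<odot> B) \<otimes> Id C ?I)"
    using A B by (simp add: triangle)
  finally show "((Id C A \<otimes> Runit C B) \<cdot> ?a) \<otimes> Id C ?I = Runit C (A \<odot> B) \<otimes> Id C ?I"
    by (rule iso_cancel_left) (use A B in auto)
qed (use A B in auto)

text \<open>By naturality, \<open>id\<^sub>I \<odot> \<lambda>\<^sub>I\<close> is \<open>\<lambda>\<close> at \<open>I \<odot> I\<close>; comparing the two expressions for \<open>\<lambda>\<^sub>I \<odot> id\<^sub>I\<close> and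
  \<open>\<rho>\<^sub>I \<odot> id\<^sub>I\<close> gives the claim.\<close>

lemma Lunit_Unit: "Lunit C (Unit C) = Runit C (Unit C)"
proof (rule tensor_Unit_faithful)
  let ?I = "Unit C"
  have "Id C ?I \<otimes> Lunit C ?I = Lunit C (?I \<odot> ?I)"
    by (rule iso_cancel_left[where f = "Lunit C ?I"]) (use Lunit_nat[of "Lunit C ?I"] in auto)
  then show "Lunit C ?I \<otimes> Id C ?I = Runit C ?I \<otimes> Id C ?I"
    using Lunit_tensor[of ?I ?I] triangle[of ?I ?I] by simp
qed auto

text \<open>The hexagon for \<open>A, I, I\<close>, composed with left unitors, reads \<open>s (\<rho>\<^sub>A \<odot> id\<^sub>I) = s (s \<odot> id\<^sub>I)\<close> for the
  isomorphism \<open>s = \<lambda>\<^sub>A swap\<close>.\<close>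

lemma Lunit_Swap:
  assumes A: "A \<in> Obj C"
  shows "Lunit C A \<cdot> Swap C A (Unit C) = Runit C A"
proof (rule tensor_Unit_faithful)
  let ?I = "Unit C"
  let ?ls = "Lunit C A \<cdot> Swap C A ?I"
  have "(Id C ?I \<otimes> Lunit C A) \<cdot> (Assoc C ?I ?I A \<cdot> (Swap C A (?I \<odot> ?I) \<cdot> Assoc C A ?I ?I)) =
      (Lunit C ?I \<otimes> Id C A) \<cdot> (Swap C A (?I \<odot> ?I) \<cdot> Assoc C A ?I ?I)"
    using A by (subst comp_ext[OF triangle]) (auto simp: Lunit_Unit)
  also have "\<dots> = Swap C A ?I \<cdot> ((Id C A \<otimes> Lunit C ?I) \<cdot> Assoc C A ?I ?I)"
    using A Swap_nat[of "Id C A" "Lunit C ?I"]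
      comp_ext[OF Swap_nat[of "Id C A" "Lunit C ?I"], of "Assoc C A ?I ?I"] by simp
  also have "\<dots> = Swap C A ?I \<cdot> (Runit C A \<otimes> Id C ?I)" using A by (simp add: triangle)
  finally have 1: "(Id C ?I \<otimes> Lunit C A) \<cdot> ((Id C ?I \<otimes> Swap C A ?I) \<cdot> (Assoc C ?I A ?I \<cdot> (Swap C A ?I \<otimes> Id C ?I)))
      = Swap C A ?I \<cdot> (Runit C A \<otimes> Id C ?I)"
    using A by (simp only: hexagon Unit_Obj)
  have "?ls \<cdot> (Runit C A \<otimes> Id C ?I) = Lunit C A \<cdot> (Swap C A ?I \<cdot> (Runit C A \<otimes> Id C ?I))"
    using A by simp
  also have "\<dots> = Lunit C A \<cdot> ((Id C ?I \<otimes> ?ls) \<cdot> (Assoc C ?I A ?I \<cdot> (Swap C A ?I \<otimes> Id C ?I)))"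
    using A by (simp flip: 1)
  also have "\<dots> = ?ls \<cdot> (Lunit C (A \<odot> ?I) \<cdot> (Assoc C ?I A ?I \<cdot> (Swap C A ?I \<otimes> Id C ?I)))"
    using A comp_ext[OF Lunit_nat[of ?ls], of "Assoc C ?I A ?I \<cdot> (Swap C A ?I \<otimes> Id C ?I)"] by simp
  also have "\<dots> = ?ls \<cdot> (?ls \<otimes> Id C ?I)"
    using A by (subst comp_ext[OF Lunit_tensor]) auto
  finally show "?ls \<otimes> Id C ?I = Runit C A \<otimes> Id C ?I"
    by (rule iso_cancel_left[symmetric]) (use A in auto)
qed (use A in auto)

lemma Runit_Swap:
  assumes A: "A \<in> Obj C"
  shows "Runit C A \<cdot> Swap C (Unit C) A = Lunit C A"
  using A by (simp flip: Lunit_Swap add: Swap_Swap)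

lemma Swap_Unit: "Swap C (Unit C) (Unit C) = Id C (Unit C \<odot> Unit C)"
  by (rule iso_cancel_left[where f = "Lunit C (Unit C)"]) (use Lunit_Swap[of "Unit C"] Lunit_Unit in auto)

end

section \<open>Pairing\<close>

text \<open>The exchange of the two middle factors; \<open>mid_swap\<close> is the case of two pairs of equal factors. Allowing
  four different objects makes it natural in each factor and applicable to units.\<close>

definition mid4 :: "('o, 'm, 'x) monoidal_data_scheme \<Rightarrow> 'o \<Rightarrow> 'o \<Rightarrow> 'o \<Rightarrow> 'o \<Rightarrow> 'm" where
  "mid4 C X Y Z W =
     inv_arr C (Assoc C X Z (Y \<odot>\<^bsub>C\<^esub> W)) \<cdot>\<^bsub>C\<^esub>
     (Id C X \<otimes>\<^bsub>C\<^esub> (Assoc C Z Y W \<cdot>\<^bsub>C\<^esub> (Swap C Y Z \<otimes>\<^bsub>C\<^esub> Id C W) \<cdot>\<^bsub>C\<^esub> inv_arr C (Assoc C Y Z W))) \<cdot>\<^bsub>C\<^esub>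
     Assoc C X Y (Z \<odot>\<^bsub>C\<^esub> W)"

context symmetric_monoidal_category
begin

lemma mid4_arr [simp]:
  assumes "X \<in> Obj C" "Y \<in> Obj C" "Z \<in> Obj C" "W \<in> Obj C"
  shows "mid4 C X Y Z W \<in> Arr C" "Dom C (mid4 C X Y Z W) = (X \<odot> Y) \<odot> (Z \<odot> W)"
    "Cod C (mid4 C X Y Z W) = (X \<odot> Z) \<odot> (Y \<odot> W)"
  using assms by (simp_all add: mid4_def)

lemma mid4_nat:
  assumes "f \<in> Arr C" "g \<in> Arr C" "h \<in> Arr C" "k \<in> Arr C"
  shows "mid4 C (Cod C f) (Cod C g) (Cod C h) (Cod C k) \<cdot> ((f \<otimes> g) \<otimes> (h \<otimes> k)) =
    ((f \<otimes> h) \<otimes> (g \<otimes> k)) \<cdot> mid4 C (Dom C f) (Dom C g) (Dom C h) (Dom C k)"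
proof -
  let ?m = "\<lambda>Y Z W. Assoc C Z Y W \<cdot> (Swap C Y Z \<otimes> Id C W) \<cdot> inv_arr C (Assoc C Y Z W)"
  let ?m' = "?m (Cod C g) (Cod C h) (Cod C k)" and ?m0 = "?m (Dom C g) (Dom C h) (Dom C k)"
  have "?m' \<cdot> (g \<otimes> (h \<otimes> k)) = Assoc C (Cod C h) (Cod C g) (Cod C k) \<cdot> ((Swap C (Cod C g) (Cod C h) \<otimes> Id C (Cod C k))
      \<cdot> (((g \<otimes> h) \<otimes> k) \<cdot> inv_arr C (Assoc C (Dom C g) (Dom C h) (Dom C k))))"
    using assms Assoc_inv_nat[of g h k] by simp
  also have "\<dots> = Assoc C (Cod C h) (Cod C g) (Cod C k) \<cdot> (((h \<otimes> g) \<otimes> k) \<cdot> ((Swap C (Dom C g) (Dom C h) \<otimes> Id C (Dom C k))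
      \<cdot> inv_arr C (Assoc C (Dom C g) (Dom C h) (Dom C k))))"
    using assms Swap_nat[of g h] by simp
  also have "\<dots> = (h \<otimes> (g \<otimes> k)) \<cdot> ?m0"
    using assms by (subst comp_ext[OF Assoc_nat]) auto
  finally have m: "?m' \<cdot> (g \<otimes> (h \<otimes> k)) = (h \<otimes> (g \<otimes> k)) \<cdot> ?m0" .
  have "mid4 C (Cod C f) (Cod C g) (Cod C h) (Cod C k) \<cdot> ((f \<otimes> g) \<otimes> (h \<otimes> k)) =
    inv_arr C (Assoc C (Cod C f) (Cod C h) (Cod C g \<odot> Cod C k)) \<cdot> ((Id C (Cod C f) \<otimes> ?m') \<cdot>
    ((f \<otimes> (g \<otimes> (h \<otimes> k))) \<cdot> Assoc C (Dom C f) (Dom C g) (Dom C h \<odot> Dom C k)))"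
    using assms Assoc_nat[of f g "h \<otimes> k"] by (simp add: mid4_def)
  also have "\<dots> = inv_arr C (Assoc C (Cod C f) (Cod C h) (Cod C g \<odot> Cod C k)) \<cdot> ((f \<otimes> (h \<otimes> (g \<otimes> k))) \<cdot>
      ((Id C (Dom C f) \<otimes> ?m0) \<cdot> Assoc C (Dom C f) (Dom C g) (Dom C h \<odot> Dom C k)))"
  proof -
    have "(Id C (Cod C f) \<otimes> ?m') \<cdot> (f \<otimes> (g \<otimes> (h \<otimes> k))) = (f \<otimes> (h \<otimes> (g \<otimes> k))) \<cdot> (Id C (Dom C f) \<otimes> ?m0)"
      using assms by (subst (1 2) interchange) (simp_all only: m, simp_all)
    from comp_ext[OF this, of "Assoc C (Dom C f) (Dom C g) (Dom C h \<odot> Dom C k)"] show ?thesis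
      using assms by (simp del: interchange interchange_ext)
  qed
  also have "\<dots> = ((f \<otimes> h) \<otimes> (g \<otimes> k)) \<cdot> mid4 C (Dom C f) (Dom C g) (Dom C h) (Dom C k)"
    using assms comp_ext[OF Assoc_inv_nat[of f h "g \<otimes> k"]]
    by (simp add: mid4_def del: interchange interchange_ext)
  finally show ?thesis .
qed

lemma triangle_inv:
  assumes "A \<in> Obj C" "B \<in> Obj C"
  shows "(Runit C A \<otimes> Id C B) \<cdot> inv_arr C (Assoc C A (Unit C) B) = Id C A \<otimes> Lunit C B"
  by (rule iso_cancel_right[where f = "Assoc C A (Unit C) B"]) (use assms triangle[of A B] in auto)

lemma Lunit_tensor_inv:
  assumes "A \<in> Obj C" "B \<in> Obj C"
  shows "(Lunit C A \<otimes> Id C B) \<cdot> inv_arr C (Assoc C (Unit C) A B) = Lunit C (A \<odot> B)"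
  by (rule iso_cancel_right[where f = "Assoc C (Unit C) A B"]) (use assms Lunit_tensor[of A B] in auto)

lemma Runit_tensor_inv:
  assumes "A \<in> Obj C" "B \<in> Obj C"
  shows "Runit C (A \<odot> B) \<cdot> inv_arr C (Assoc C A B (Unit C)) = Id C A \<otimes> Runit C B"
  by (rule iso_cancel_right[where f = "Assoc C A B (Unit C)"]) (use assms Runit_tensor[of A B] in auto)

text \<open>This law and the next one say that the unitors respect the copying morphisms of tensor products.\<close>

lemma mid4_Runit:
  assumes X: "X \<in> Obj C" and Y: "Y \<in> Obj C"
  shows "(Runit C X \<otimes> Runit C Y) \<cdot> mid4 C X Y (Unit C) (Unit C) =
    Runit C (X \<odot> Y) \<cdot> (Id C (X \<odot> Y) \<otimes> Lunit C (Unit C))"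
proof -
  let ?I = "Unit C"
  have 1: "(Runit C X \<otimes> Runit C Y) \<cdot> inv_arr C (Assoc C X ?I (Y \<odot> ?I)) = Id C X \<otimes> (Runit C Y \<cdot> Lunit C (Y \<odot> ?I))"
  proof -
    have "(Runit C X \<otimes> Runit C Y) \<cdot> inv_arr C (Assoc C X ?I (Y \<odot> ?I)) =
      (Id C X \<otimes> Runit C Y) \<cdot> ((Runit C X \<otimes> Id C (Y \<odot> ?I)) \<cdot> inv_arr C (Assoc C X ?I (Y \<odot> ?I)))"
      using X Y by simp
    also have "\<dots> = Id C X \<otimes> (Runit C Y \<cdot> Lunit C (Y \<odot> ?I))"
      using X Y by (subst triangle_inv) auto
    finally show ?thesis .
  qed
  have "(Runit C Y \<cdot> Lunit C (Y \<odot> ?I)) \<cdot> (Assoc C ?I Y ?I \<cdot> (Swap C Y ?I \<otimes> Id C ?I) \<cdot> inv_arr C (Assoc C Y ?I ?I)) =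
     Runit C Y \<cdot> ((Lunit C Y \<otimes> Id C ?I) \<cdot> ((Swap C Y ?I \<otimes> Id C ?I) \<cdot> inv_arr C (Assoc C Y ?I ?I)))"
    using X Y comp_ext[OF Lunit_tensor[of Y ?I]] by simp
  also have "\<dots> = Runit C Y \<cdot> (Id C Y \<otimes> Lunit C ?I)"
    using X Y triangle_inv[of Y ?I] by (simp add: Lunit_Swap)
  finally have 2: "(Runit C Y \<cdot> Lunit C (Y \<odot> ?I)) \<cdot> (Assoc C ?I Y ?I \<cdot> (Swap C Y ?I \<otimes> Id C ?I) \<cdot> inv_arr C (Assoc C Y ?I ?I))
     = Runit C Y \<cdot> (Id C Y \<otimes> Lunit C ?I)" .
  have "(Runit C X \<otimes> Runit C Y) \<cdot> mid4 C X Y ?I ?I = (Id C X \<otimes> (Runit C Y \<cdot> (Id C Y \<otimes> Lunit C ?I))) \<cdot> Assoc C X Y (?I \<odot> ?I)"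
    unfolding mid4_def using X Y by (subst comp_ext[OF 1]) (simp_all add: 2[simplified])
  also have "\<dots> = (Id C X \<otimes> Runit C Y) \<cdot> ((Id C X \<otimes> (Id C Y \<otimes> Lunit C ?I)) \<cdot> Assoc C X Y (?I \<odot> ?I))"
    using X Y by simp
  also have "\<dots> = (Id C X \<otimes> Runit C Y) \<cdot> (Assoc C X Y ?I \<cdot> (Id C (X \<odot> Y) \<otimes> Lunit C ?I))"
    using X Y Assoc_nat[of "Id C X" "Id C Y" "Lunit C ?I"] by simp
  also have "\<dots> = Runit C (X \<odot> Y) \<cdot> (Id C (X \<odot> Y) \<otimes> Lunit C ?I)"
    using X Y by (subst comp_ext[OF Runit_tensor]) auto
  finally show ?thesis .
qed

lemma mid4_Lunit:
  assumes X: "X \<in> Obj C" and Y: "Y \<in> Obj C"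
  shows "(Lunit C X \<otimes> Lunit C Y) \<cdot> mid4 C (Unit C) (Unit C) X Y =
    Lunit C (X \<odot> Y) \<cdot> (Lunit C (Unit C) \<otimes> Id C (X \<odot> Y))"
proof -
  let ?I = "Unit C"
  have 1: "(Lunit C X \<otimes> Lunit C Y) \<cdot> inv_arr C (Assoc C ?I X (?I \<odot> Y)) =
      Lunit C (X \<odot> Y) \<cdot> (Id C ?I \<otimes> (Id C X \<otimes> Lunit C Y))"
  proof -
    have "(Lunit C X \<otimes> Lunit C Y) \<cdot> inv_arr C (Assoc C ?I X (?I \<odot> Y)) =
      (Id C X \<otimes> Lunit C Y) \<cdot> ((Lunit C X \<otimes> Id C (?I \<odot> Y)) \<cdot> inv_arr C (Assoc C ?I X (?I \<odot> Y)))"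
      using X Y by simp
    also have "\<dots> = (Id C X \<otimes> Lunit C Y) \<cdot> Lunit C (X \<odot> (?I \<odot> Y))"
      using X Y by (simp add: Lunit_tensor_inv del: interchange_ext)
    also have "\<dots> = Lunit C (X \<odot> Y) \<cdot> (Id C ?I \<otimes> (Id C X \<otimes> Lunit C Y))"
      using X Y Lunit_nat[of "Id C X \<otimes> Lunit C Y"] by simp
    finally show ?thesis .
  qed
  have "(Id C X \<otimes> Lunit C Y) \<cdot> (Assoc C X ?I Y \<cdot> (Swap C ?I X \<otimes> Id C Y) \<cdot> inv_arr C (Assoc C ?I X Y)) =
     (Lunit C X \<otimes> Id C Y) \<cdot> inv_arr C (Assoc C ?I X Y)"
    using X Y by (subst comp_ext[OF triangle]) (auto simp: Runit_Swap)
  then have 2: "(Id C X \<otimes> Lunit C Y) \<cdot> (Assoc C X ?I Y \<cdot> (Swap C ?I X \<otimes> Id C Y) \<cdot> inv_arr C (Assoc C ?I X Y)) =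
     Lunit C (X \<odot> Y)"
    using X Y by (simp add: Lunit_tensor_inv)
  have "(Lunit C X \<otimes> Lunit C Y) \<cdot> mid4 C ?I ?I X Y =
      Lunit C (X \<odot> Y) \<cdot> ((Id C ?I \<otimes> Lunit C (X \<odot> Y)) \<cdot> Assoc C ?I ?I (X \<odot> Y))"
    unfolding mid4_def using X Y by (subst comp_ext[OF 1]) (simp_all add: 2)
  also have "\<dots> = Lunit C (X \<odot> Y) \<cdot> (Lunit C ?I \<otimes> Id C (X \<odot> Y))"
    using X Y by (simp add: triangle Lunit_Unit)
  finally show ?thesis .
qed

lemma mid4_Unit_middle:
  assumes "A \<in> Obj C" "B \<in> Obj C"
  shows "mid4 C A (Unit C) (Unit C) B = Id C ((A \<odot> Unit C) \<odot> (Unit C \<odot> B))"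
  using assms by (simp add: mid4_def Swap_Unit)

end

context involutive_markov_category
begin

text \<open>A morphism into a tensor product is often a pair \<open>\<langle>f, g\<rangle>\<close>. Structural morphisms act on nested pairs
  as they would on tuples of elements: rebracketing is coassociativity, and dropping an entry is
  counitality. The exception is \<open>Swap\<close>, which may exchange \<open>f\<close> and \<open>g\<close> only if they are compatible, and
  precomposition \<open>\<langle>f, g\<rangle> \<cdot> h = \<langle>f \<cdot> h, g \<cdot> h\<rangle>\<close>, which needs \<open>h\<close> to be deterministic.\<close>

abbreviation pairing (\<open>\<langle>_, _\<rangle>\<close>) where "\<langle>f, g\<rangle> \<equiv> pair C f g"

lemma Copy_arr [simp]:
  assumes "A \<in> Obj C"
  shows "Copy C A \<in> Arr C" "Dom C (Copy C A) = A" "Cod C (Copy C A) = A \<odot> A"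
  using Copy_hom[OF assms] by (auto simp: hom_def)

lemma Del_arr [simp]:
  assumes "A \<in> Obj C"
  shows "Del C A \<in> Arr C" "Dom C (Del C A) = A" "Cod C (Del C A) = Unit C"
  using Del_hom[OF assms] by (auto simp: hom_def)

lemma Del_comp [simp]: "f \<in> Arr C \<Longrightarrow> Cod C f = B \<Longrightarrow> Del C B \<cdot> f = Del C (Dom C f)"
  using Del_natural[OF in_hom] by auto

lemma terminal_Unit: "f \<in> Arr C \<Longrightarrow> Cod C f = Unit C \<Longrightarrow> f = Del C (Dom C f)"
  using Del_comp[of f "Unit C"] by (simp add: Del_Unit)

lemma pair_arr [simp]:
  assumes "f \<in> Arr C" "g \<in> Arr C" "Dom C f = Dom C g"
  shows "\<langle>f, g\<rangle> \<in> Arr C" "Dom C \<langle>f, g\<rangle> = Dom C f" "Cod C \<langle>f, g\<rangle> = Cod C f \<odot> Cod C g"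
  using assms by (simp_all add: pair_def)

lemma tensor_pair [simp]:
  assumes "f \<in> Arr C" "g \<in> Arr C" "h \<in> Arr C" "k \<in> Arr C" "Dom C f = Dom C g"
    "Cod C f = Dom C h" "Cod C g = Dom C k"
  shows "(h \<otimes> k) \<cdot> \<langle>f, g\<rangle> = \<langle>h \<cdot> f, k \<cdot> g\<rangle>"
  using assms by (simp add: pair_def)

lemma Copy_eq_pair: "A \<in> Obj C \<Longrightarrow> Copy C A = \<langle>Id C A, Id C A\<rangle>"
  by (simp add: pair_def)

lemma Assoc_pair [simp]:
  assumes "f \<in> Arr C" "g \<in> Arr C" "h \<in> Arr C" "Dom C f = Dom C g" "Dom C g = Dom C h"
    "Cod C f = A" "Cod C g = B" "Cod C h = E"
  shows "Assoc C A B E \<cdot> \<langle>\<langle>f, g\<rangle>, h\<rangle> = \<langle>f, \<langle>g, h\<rangle>\<rangle>"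
proof -
  have [simp]: "A \<in> Obj C" "B \<in> Obj C" "E \<in> Obj C" using assms by auto
  let ?X = "Dom C h"
  have "Assoc C A B E \<cdot> \<langle>\<langle>f, g\<rangle>, h\<rangle> = Assoc C A B E \<cdot> (((f \<otimes> g) \<otimes> h) \<cdot> ((Copy C ?X \<otimes> Id C ?X) \<cdot> Copy C ?X))"
    using assms by (simp add: pair_def)
  also have "\<dots> = (f \<otimes> (g \<otimes> h)) \<cdot> (Assoc C ?X ?X ?X \<cdot> ((Copy C ?X \<otimes> Id C ?X) \<cdot> Copy C ?X))"
    using assms comp_ext[OF Assoc_nat[of f g h], of "(Copy C ?X \<otimes> Id C ?X) \<cdot> Copy C ?X"] by simp
  also have "\<dots> = \<langle>f, \<langle>g, h\<rangle>\<rangle>"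
    using assms by (subst Copy_coassoc) (auto simp: pair_def)
  finally show ?thesis .
qed

lemma Assoc_inv_pair [simp]:
  assumes "f \<in> Arr C" "g \<in> Arr C" "h \<in> Arr C" "Dom C f = Dom C g" "Dom C g = Dom C h"
    "Cod C f = A" "Cod C g = B" "Cod C h = E"
  shows "inv_arr C (Assoc C A B E) \<cdot> \<langle>f, \<langle>g, h\<rangle>\<rangle> = \<langle>\<langle>f, g\<rangle>, h\<rangle>"
  by (rule iso_cancel_left[where f = "Assoc C A B E"]) (use assms in auto)

lemma Runit_pair [simp]:
  assumes "f \<in> Arr C" "g \<in> Arr C" "Dom C f = Dom C g" "Cod C f = A" "Cod C g = Unit C"
  shows "Runit C A \<cdot> \<langle>f, g\<rangle> = f"
proof -
  have [simp]: "A \<in> Obj C" using assms by auto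
  let ?X = "Dom C f"
  have "Runit C A \<cdot> \<langle>f, g\<rangle> = Runit C A \<cdot> ((f \<otimes> Id C (Unit C)) \<cdot> ((Id C ?X \<otimes> Del C ?X) \<cdot> Copy C ?X))"
    using assms terminal_Unit[of g] by (simp add: pair_def)
  also have "\<dots> = f \<cdot> (Runit C ?X \<cdot> ((Id C ?X \<otimes> Del C ?X) \<cdot> Copy C ?X))"
    using assms comp_ext[OF Runit_nat[of f], of "(Id C ?X \<otimes> Del C ?X) \<cdot> Copy C ?X"] by simp
  finally show ?thesis using assms by (simp only: counit_right Dom_Cod_Obj) simp
qed

lemma Lunit_pair [simp]:
  assumes "f \<in> Arr C" "g \<in> Arr C" "Dom C f = Dom C g" "Cod C f = A" "Cod C g = Unit C"
  shows "Lunit C A \<cdot> \<langle>g, f\<rangle> = f"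
proof -
  have [simp]: "A \<in> Obj C" using assms by auto
  let ?X = "Dom C f"
  have "Lunit C A \<cdot> \<langle>g, f\<rangle> = Lunit C A \<cdot> ((Id C (Unit C) \<otimes> f) \<cdot> ((Del C ?X \<otimes> Id C ?X) \<cdot> Copy C ?X))"
    using assms terminal_Unit[of g] by (simp add: pair_def)
  also have "\<dots> = f \<cdot> (Lunit C ?X \<cdot> ((Del C ?X \<otimes> Id C ?X) \<cdot> Copy C ?X))"
    using assms comp_ext[OF Lunit_nat[of f], of "(Del C ?X \<otimes> Id C ?X) \<cdot> Copy C ?X"] by simp
  finally show ?thesis using assms by (simp only: counit_left Dom_Cod_Obj) simp
qed

text \<open>The compatibility of copying with tensor products, in terms of pairs.\<close>

lemma pair_tensor:
  assumes "f \<in> Arr C" "g \<in> Arr C" "h \<in> Arr C" "k \<in> Arr C" "Dom C f = Dom C h" "Dom C g = Dom C k"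
  shows "\<langle>f \<otimes> g, h \<otimes> k\<rangle> = mid4 C (Cod C f) (Cod C h) (Cod C g) (Cod C k) \<cdot> (\<langle>f, h\<rangle> \<otimes> \<langle>g, k\<rangle>)"
proof -
  let ?X = "Dom C h" and ?Y = "Dom C k"
  have "\<langle>f \<otimes> g, h \<otimes> k\<rangle> = ((f \<otimes> g) \<otimes> (h \<otimes> k)) \<cdot> (mid4 C ?X ?X ?Y ?Y \<cdot> (Copy C ?X \<otimes> Copy C ?Y))"
    using assms Copy_tensor[of ?X ?Y] by (simp add: pair_def mid4_def mid_swap_def)
  also have "\<dots> = mid4 C (Cod C f) (Cod C h) (Cod C g) (Cod C k) \<cdot> (((f \<otimes> h) \<otimes> (g \<otimes> k)) \<cdot> (Copy C ?X \<otimes> Copy C ?Y))"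
    using assms comp_ext[OF mid4_nat[of f h g k], of "Copy C ?X \<otimes> Copy C ?Y"]
    by (simp del: interchange interchange_ext)
  also have "\<dots> = mid4 C (Cod C f) (Cod C h) (Cod C g) (Cod C k) \<cdot> (\<langle>f, h\<rangle> \<otimes> \<langle>g, k\<rangle>)"
    using assms by (simp add: pair_def)
  finally show ?thesis .
qed

lemma mid4_pair:
  assumes "a \<in> Arr C" "b \<in> Arr C" "c \<in> Arr C" "d \<in> Arr C" "Dom C a = X" "Dom C b = X" "Dom C c = X" "Dom C d = X"
    "Swap C (Cod C b) (Cod C c) \<cdot> \<langle>b, c\<rangle> = \<langle>c, b\<rangle>"
  shows "mid4 C (Cod C a) (Cod C b) (Cod C c) (Cod C d) \<cdot> \<langle>\<langle>a, b\<rangle>, \<langle>c, d\<rangle>\<rangle> = \<langle>\<langle>a, c\<rangle>, \<langle>b, d\<rangle>\<rangle>"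
  using assms by (simp add: mid4_def)

section \<open>Deterministic morphisms\<close>

lemma Bar_arr [simp]:
  assumes "f \<in> Arr C"
  shows "Bar C f \<in> Arr C" "Dom C (Bar C f) = Dom C f" "Cod C (Bar C f) = Cod C f"
  using Bar_hom[OF in_hom[OF assms]] by (auto simp: hom_def)

lemma Bar_comp:
  assumes "f \<in> Arr C" "g \<in> Arr C" "Cod C f = Dom C g"
  shows "Bar C (g \<cdot> f) = Bar C g \<cdot> Bar C f"
  using Bar_Comp[of f "Dom C f" "Dom C g" g "Cod C g"] assms by (simp add: hom_def)

text \<open>The involution reverses pairs because it reverses copying. Hence self-adjointness of a pair of
  self-adjoint morphisms is the same as compatibility of its entries.\<close>

lemma Bar_pair:
  assumes "f \<in> Arr C" "g \<in> Arr C" "Dom C f = Dom C g" "self_adjoint C f" "self_adjoint C g"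
  shows "Bar C \<langle>f, g\<rangle> = Swap C (Cod C g) (Cod C f) \<cdot> \<langle>g, f\<rangle>"
proof -
  let ?X = "Dom C f"
  have "Bar C \<langle>f, g\<rangle> = (f \<otimes> g) \<cdot> (Swap C ?X ?X \<cdot> Copy C ?X)"
    using assms by (simp add: pair_def Bar_comp Bar_TensorM Bar_Copy self_adjoint_def)
  also have "\<dots> = Swap C (Cod C g) (Cod C f) \<cdot> \<langle>g, f\<rangle>"
    using assms comp_ext[OF Swap_nat[of g f], of "Copy C ?X"] by (simp add: pair_def)
  finally show ?thesis .
qed

lemma Swap_pair_flip:
  assumes "f \<in> Arr C" "g \<in> Arr C" "Dom C f = Dom C g" "Swap C (Cod C f) (Cod C g) \<cdot> \<langle>f, g\<rangle> = \<langle>g, f\<rangle>"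
  shows "Swap C (Cod C g) (Cod C f) \<cdot> \<langle>g, f\<rangle> = \<langle>f, g\<rangle>"
  using assms comp_ext[OF Swap_Swap[of "Cod C f" "Cod C g"], of "\<langle>f, g\<rangle>"] by simp

lemma Det_arr: "f \<in> Det C \<Longrightarrow> f \<in> Arr C"
  by (simp add: Det_def)

lemma pair_Det:
  assumes "h \<in> Det C" "f \<in> Arr C" "g \<in> Arr C" "Dom C f = Cod C h" "Dom C g = Cod C h"
  shows "\<langle>f, g\<rangle> \<cdot> h = \<langle>f \<cdot> h, g \<cdot> h\<rangle>"
proof -
  have h: "h \<in> Arr C" "Copy C (Cod C h) \<cdot> h = (h \<otimes> h) \<cdot> Copy C (Dom C h)" using assms(1) by (auto simp: Det_def)
  then show ?thesis using assms(2-) by (simp add: pair_def)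
qed

lemma DetI: "f \<in> Arr C \<Longrightarrow> self_adjoint C f \<Longrightarrow> Copy C (Cod C f) \<cdot> f = \<langle>f, f\<rangle> \<Longrightarrow> f \<in> Det C"
  by (simp add: Det_def pair_def)

lemma Det_Copy: "f \<in> Det C \<Longrightarrow> Copy C (Cod C f) \<cdot> f = \<langle>f, f\<rangle>"
  by (simp add: Det_def pair_def)

lemma Det_self_adjoint: "f \<in> Det C \<Longrightarrow> self_adjoint C f"
  by (simp add: Det_def)

lemma Det_Id [simp]: "A \<in> Obj C \<Longrightarrow> Id C A \<in> Det C"
  by (rule DetI) (auto simp: self_adjoint_def Bar_Id Copy_eq_pair)

lemma Det_comp [simp]:
  assumes "f \<in> Det C" "g \<in> Det C" "Cod C f = Dom C g"
  shows "g \<cdot> f \<in> Det C"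
proof (rule DetI)
  have a: "f \<in> Arr C" "g \<in> Arr C" using assms by (auto intro: Det_arr)
  show "g \<cdot> f \<in> Arr C" using a assms by simp
  show "self_adjoint C (g \<cdot> f)" using assms a by (simp add: Det_def self_adjoint_def Bar_comp)
  have "Copy C (Cod C g) \<cdot> (g \<cdot> f) = \<langle>g, g\<rangle> \<cdot> f"
    using a assms(3) by (rule_tac comp_ext[OF Det_Copy[OF assms(2)]]) auto
  then show "Copy C (Cod C (g \<cdot> f)) \<cdot> (g \<cdot> f) = \<langle>g \<cdot> f, g \<cdot> f\<rangle>"
    using a assms by (simp add: pair_Det)
qed

lemma Det_Del [simp]:
  assumes "A \<in> Obj C"
  shows "Del C A \<in> Det C"
proof (rule DetI)
  have "Copy C (Unit C) \<cdot> Del C A = \<langle>Del C A, Del C A\<rangle>"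
    by (rule iso_cancel_left[where f = "Lunit C (Unit C)"]) (use assms in \<open>auto simp: Copy_Unit\<close>)
  then show "Copy C (Cod C (Del C A)) \<cdot> Del C A = \<langle>Del C A, Del C A\<rangle>" using assms by simp
qed (use assms in \<open>auto simp: self_adjoint_def Bar_Del\<close>)

lemma Det_tensor [simp]:
  assumes "f \<in> Det C" "g \<in> Det C"
  shows "f \<otimes> g \<in> Det C"
proof (rule DetI)
  have a: "f \<in> Arr C" "g \<in> Arr C" using assms by (auto intro: Det_arr)
  show "f \<otimes> g \<in> Arr C" using a by simp
  show "self_adjoint C (f \<otimes> g)" using assms a by (simp add: Det_def self_adjoint_def Bar_TensorM)
  have "Copy C (Cod C f \<odot> Cod C g) \<cdot> (f \<otimes> g) =
    (mid4 C (Cod C f) (Cod C f) (Cod C g) (Cod C g) \<cdot> (Copy C (Cod C f) \<otimes> Copy C (Cod C g))) \<cdot> (f \<otimes> g)"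
    using a by (simp add: Copy_tensor mid4_def mid_swap_def)
  also have "\<dots> = mid4 C (Cod C f) (Cod C f) (Cod C g) (Cod C g) \<cdot> (\<langle>f, f\<rangle> \<otimes> \<langle>g, g\<rangle>)"
    using a assms by (simp add: Det_Copy)
  finally show "Copy C (Cod C (f \<otimes> g)) \<cdot> (f \<otimes> g) = \<langle>f \<otimes> g, f \<otimes> g\<rangle>"
    using a by (simp add: pair_tensor)
qed

lemma Det_Runit [simp]:
  assumes A: "A \<in> Obj C"
  shows "Runit C A \<in> Det C"
proof (rule DetI)
  let ?I = "Unit C"
  have "\<langle>Runit C A, Runit C A\<rangle> = (Runit C A \<otimes> Runit C A) \<cdot> (mid4 C A A ?I ?I \<cdot> (Copy C A \<otimes> Copy C ?I))"
    using A Copy_tensor[of A ?I] by (simp add: pair_def mid4_def mid_swap_def)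
  also have "\<dots> = Runit C (A \<odot> A) \<cdot> (Copy C A \<otimes> Id C ?I)"
    using A by (subst comp_ext[OF mid4_Runit]) (auto simp: Copy_Unit)
  also have "\<dots> = Copy C A \<cdot> Runit C A"
    using A Runit_nat[of "Copy C A"] by simp
  finally show "Copy C (Cod C (Runit C A)) \<cdot> Runit C A = \<langle>Runit C A, Runit C A\<rangle>" using A by simp
qed (use A in \<open>auto simp: self_adjoint_def Bar_Runit\<close>)

lemma Det_Lunit [simp]:
  assumes A: "A \<in> Obj C"
  shows "Lunit C A \<in> Det C"
proof (rule DetI)
  let ?I = "Unit C"
  have "\<langle>Lunit C A, Lunit C A\<rangle> = (Lunit C A \<otimes> Lunit C A) \<cdot> (mid4 C ?I ?I A A \<cdot> (Copy C ?I \<otimes> Copy C A))"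
    using A Copy_tensor[of ?I A] by (simp add: pair_def mid4_def mid_swap_def)
  also have "\<dots> = Lunit C (A \<odot> A) \<cdot> (Id C ?I \<otimes> Copy C A)"
    using A by (subst comp_ext[OF mid4_Lunit]) (auto simp: Copy_Unit)
  also have "\<dots> = Copy C A \<cdot> Lunit C A"
    using A Lunit_nat[of "Copy C A"] by simp
  finally show "Copy C (Cod C (Lunit C A)) \<cdot> Lunit C A = \<langle>Lunit C A, Lunit C A\<rangle>" using A by simp
qed (use A in \<open>auto simp: self_adjoint_def Bar_Lunit\<close>)

lemma Det_inv_arr:
  assumes "f \<in> Det C" "is_iso C f"
  shows "inv_arr C f \<in> Det C"
proof (rule DetI)
  let ?g = "inv_arr C f"
  have f: "f \<in> Arr C" using assms by (auto intro: Det_arr)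
  have "Bar C f = f" using Det_self_adjoint[OF assms(1)] by (simp add: self_adjoint_def)
  then have "Bar C ?g \<cdot> f = Bar C (?g \<cdot> f)"
    using f assms(2) by (subst Bar_comp) auto
  also have "\<dots> = ?g \<cdot> f" using f assms(2) by (simp add: Bar_Id)
  finally have "Bar C ?g = ?g"
    by (rule iso_cancel_right) (use f assms(2) in auto)
  then show "self_adjoint C ?g" by (simp add: self_adjoint_def)
  have "\<langle>?g, ?g\<rangle> \<cdot> f = Copy C (Dom C f)"
    using f assms by (simp add: pair_Det Copy_eq_pair)
  then show "Copy C (Cod C ?g) \<cdot> ?g = \<langle>?g, ?g\<rangle>"
    by (intro iso_cancel_right[OF _ assms(2), of _ "\<langle>?g, ?g\<rangle>"]) (use f assms(2) in auto)
qed (use assms in auto)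

section \<open>Projections from a tensor product\<close>

definition prl where
  "prl A B = Runit C A \<cdot> (Id C A \<otimes> Del C B)"

definition prr where
  "prr A B = Lunit C B \<cdot> (Del C A \<otimes> Id C B)"

lemma pr_arr [simp]:
  assumes "A \<in> Obj C" "B \<in> Obj C"
  shows "prl A B \<in> Arr C" "Dom C (prl A B) = A \<odot> B" "Cod C (prl A B) = A"
    "prr A B \<in> Arr C" "Dom C (prr A B) = A \<odot> B" "Cod C (prr A B) = B"
  using assms by (simp_all add: prl_def prr_def)

lemma Det_pr [simp]:
  assumes "A \<in> Obj C" "B \<in> Obj C"
  shows "prl A B \<in> Det C" "prr A B \<in> Det C"
  using assms by (simp_all add: prl_def prr_def)

lemma prl_tensor:
  assumes "f \<in> Arr C" "g \<in> Arr C" "Cod C f = A" "Cod C g = B"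
  shows "prl A B \<cdot> (f \<otimes> g) = f \<cdot> prl (Dom C f) (Dom C g)"
proof -
  have [simp]: "A \<in> Obj C" "B \<in> Obj C" using assms by auto
  have "prl A B \<cdot> (f \<otimes> g) = Runit C A \<cdot> ((f \<otimes> Id C (Unit C)) \<cdot> (Id C (Dom C f) \<otimes> Del C (Dom C g)))"
    using assms by (auto simp: prl_def)
  also have "\<dots> = f \<cdot> prl (Dom C f) (Dom C g)"
    using assms comp_ext[OF Runit_nat[of f], of "Id C (Dom C f) \<otimes> Del C (Dom C g)"]
    by (auto simp add: prl_def simp del: interchange)
  finally show ?thesis .
qed

lemma prr_tensor:
  assumes "f \<in> Arr C" "g \<in> Arr C" "Cod C f = A" "Cod C g = B"
  shows "prr A B \<cdot> (f \<otimes> g) = g \<cdot> prr (Dom C f) (Dom C g)"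
proof -
  have [simp]: "A \<in> Obj C" "B \<in> Obj C" using assms by auto
  have "prr A B \<cdot> (f \<otimes> g) = Lunit C B \<cdot> ((Id C (Unit C) \<otimes> g) \<cdot> (Del C (Dom C f) \<otimes> Id C (Dom C g)))"
    using assms by (auto simp: prr_def)
  also have "\<dots> = g \<cdot> prr (Dom C f) (Dom C g)"
    using assms comp_ext[OF Lunit_nat[of g], of "Del C (Dom C f) \<otimes> Id C (Dom C g)"]
    by (auto simp add: prr_def simp del: interchange)
  finally show ?thesis .
qed

lemma prr_pair [simp]:
  assumes "f \<in> Arr C" "g \<in> Arr C" "Dom C f = Dom C g" "Cod C f = A" "Cod C g = B"
  shows "prr A B \<cdot> \<langle>f, g\<rangle> = g"
  using assms by (auto simp add: prr_def)

text \<open>Copying \<open>A \<odot> B\<close> and deleting one factor on each side leaves \<open>copy\<^sub>A\<close> and \<open>copy\<^sub>B\<close> with one output deleted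
  each; the exchange in the middle only concerns copies of the unit object.\<close>

lemma pair_pr:
  assumes A: "A \<in> Obj C" and B: "B \<in> Obj C"
  shows "\<langle>prl A B, prr A B\<rangle> = Id C (A \<odot> B)"
proof -
  let ?I = "Unit C"
  have "\<langle>prl A B, prr A B\<rangle> = (Runit C A \<otimes> Lunit C B) \<cdot> \<langle>Id C A \<otimes> Del C B, Del C A \<otimes> Id C B\<rangle>"
    using A B by (simp add: prl_def prr_def)
  also have "\<dots> = (Runit C A \<cdot> \<langle>Id C A, Del C A\<rangle>) \<otimes> (Lunit C B \<cdot> \<langle>Del C B, Id C B\<rangle>)"
    using A B by (simp add: pair_tensor mid4_Unit_middle del: Runit_pair Lunit_pair)
  finally show ?thesis using A B by simp
qed

text \<open>Precomposing \<open>id = \<langle>p, q\<rangle>\<close> with a deterministic morphism decomposes it into its marginals. As it is also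
  self-adjoint, applying the involution shows that the marginals are compatible, so the order of the
  pair may be reversed.\<close>

lemma Det_eq_pair:
  assumes h: "h \<in> Det C" and X: "Cod C h = A \<odot> B" "A \<in> Obj C" "B \<in> Obj C"
  shows "\<langle>prl A B \<cdot> h, prr A B \<cdot> h\<rangle> = h"
    and "Swap C B A \<cdot> \<langle>prr A B \<cdot> h, prl A B \<cdot> h\<rangle> = h"
proof -
  have a: "h \<in> Arr C" using h by (rule Det_arr)
  have "\<langle>prl A B \<cdot> h, prr A B \<cdot> h\<rangle> = \<langle>prl A B, prr A B\<rangle> \<cdot> h"
    using h X by (simp add: pair_Det)
  then show 1: "\<langle>prl A B \<cdot> h, prr A B \<cdot> h\<rangle> = h" using X a by (simp add: pair_pr)
  have "Bar C \<langle>prl A B \<cdot> h, prr A B \<cdot> h\<rangle> = Swap C B A \<cdot> \<langle>prr A B \<cdot> h, prl A B \<cdot> h\<rangle>"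
    using a h X by (subst Bar_pair) (auto intro!: Det_self_adjoint)
  moreover have "Bar C h = h" using Det_self_adjoint[OF h] by (simp add: self_adjoint_def)
  ultimately show "Swap C B A \<cdot> \<langle>prr A B \<cdot> h, prl A B \<cdot> h\<rangle> = h" by (simp add: 1)
qed

end

section \<open>Finite tensor products\<close>

lemma filter_desc_list:
  assumes "finite F" "F' \<subseteq> F"
  shows "filter (\<lambda>i. i \<in> F') (desc_list F) = desc_list F'"
proof -
  have "filter (\<lambda>i. i \<in> F') (sorted_list_of_set F) = sorted_list_of_set F'"
    using assms finite_subset[OF assms(2,1)]
    by (intro sorted_distinct_set_unique) (auto intro: sorted_filter[of id, simplified] distinct_filter)
  then show ?thesis by (simp add: desc_list_def rev_filter[symmetric])
qed

lemma desc_list [simp]: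
  assumes "finite F"
  shows "set (desc_list F) = F" "distinct (desc_list F)" "length (desc_list F) = card F"
  using assms by (simp_all add: desc_list_def)

lemma desc_list_empty [simp]: "desc_list {} = []"
  by (simp add: desc_list_def)

context symmetric_monoidal_category
begin

lemma tensor_list_Obj [simp]: "\<forall>j \<in> set js. A j \<in> Obj C \<Longrightarrow> tensor_list C A js \<in> Obj C"
  by (induction js) auto

lemma tensor_set_Obj [simp]: "finite F \<Longrightarrow> \<forall>j \<in> F. A j \<in> Obj C \<Longrightarrow> tensor_set C A F \<in> Obj C"
  by (simp add: tensor_set_def)

lemma tensor_set_empty [simp]: "tensor_set C A {} = Unit C"
  by (simp add: tensor_set_def)

end

context involutive_markov_category
begin

lemma proj_list_arr [simp]:
  assumes "\<forall>j \<in> set js. A j \<in> Obj C"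
  shows "proj_list C A F' js \<in> Arr C" "Dom C (proj_list C A F' js) = tensor_list C A js"
    "Cod C (proj_list C A F' js) = tensor_list C A (filter (\<lambda>i. i \<in> F') js)"
proof -
  have "proj_list C A F' js \<in> Arr C \<and> Dom C (proj_list C A F' js) = tensor_list C A js \<and>
    Cod C (proj_list C A F' js) = tensor_list C A (filter (\<lambda>i. i \<in> F') js)"
    using assms by (induction js) auto
  then show "proj_list C A F' js \<in> Arr C" "Dom C (proj_list C A F' js) = tensor_list C A js"
    "Cod C (proj_list C A F' js) = tensor_list C A (filter (\<lambda>i. i \<in> F') js)" by auto
qed

lemma fin_proj_arr [simp]:
  assumes "finite F" "F' \<subseteq> F" "\<forall>j \<in> F. A j \<in> Obj C"
  shows "fin_proj C A F F' \<in> Arr C" "Dom C (fin_proj C A F F') = tensor_set C A F"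
    "Cod C (fin_proj C A F F') = tensor_set C A F'"
  using assms by (simp_all add: fin_proj_def tensor_set_def filter_desc_list)

end

section \<open>Kolmogorov products\<close>

locale kolmogorov = involutive_markov_category C
  for C :: "('o, 'm, 'x) icd_data_scheme" (structure) +
  fixes D :: "'m set" and J :: "nat set" and A :: "nat \<Rightarrow> 'o" and K :: 'o
    and \<Phi> :: "'o \<Rightarrow> 'o \<Rightarrow> 'm \<Rightarrow> nat set \<Rightarrow> 'm"
  assumes product: "kolmogorov_product C D J A K \<Phi>"
    and factors: "j \<in> J \<Longrightarrow> A j \<in> Obj C"
begin

abbreviation fin where "fin F \<equiv> F \<in> Fpow J"

abbreviation T where "T F \<equiv> tensor_set C A F"

lemma K_Obj [simp]: "K \<in> Obj C"
  using product by (simp add: kolmogorov_product_def)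

lemma T_Obj [simp]: "fin F \<Longrightarrow> T F \<in> Obj C"
  by (rule tensor_set_Obj) (auto simp: Fpow_def intro: factors)

lemma Fpow_mono: "fin F \<Longrightarrow> F' \<subseteq> F \<Longrightarrow> fin F'"
  by (auto simp: Fpow_def intro: finite_subset)

lemma fin_empty [simp]: "fin {}"
  by (simp add: Fpow_def)

lemma proj_arr [simp]:
  assumes "fin F" "F' \<subseteq> F"
  shows "fin_proj C A F F' \<in> Arr C" "Dom C (fin_proj C A F F') = T F" "Cod C (fin_proj C A F F') = T F'"
  using assms fin_proj_arr[of F F' A] factors by (simp_all add: Fpow_def subset_iff)

lemma bij_\<Phi>:
  assumes "B \<in> Obj C" "E \<in> Obj C" "X \<in> {Arr C, D, Det C}"
  shows "bij_betw (\<Phi> B E) (hom C B (K \<odot> E) \<inter> X) (families C X J A B E)"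
  using product assms unfolding kolmogorov_product_def by blast

text \<open>The universal family: by naturality in the domain, the bijections \<open>\<Phi>\<close> are composition with it.\<close>

definition univ :: "'o \<Rightarrow> nat set \<Rightarrow> 'm" where
  "univ E F = \<Phi> (K \<odot> E) E (Id C (K \<odot> E)) F"

lemma \<Phi>_nat_dom:
  assumes "b \<in> hom C B' B" "\<phi> \<in> hom C B (K \<odot> E)" "B \<in> Obj C" "B' \<in> Obj C" "E \<in> Obj C" "fin F"
  shows "\<Phi> B' E (\<phi> \<cdot> b) F = \<Phi> B E \<phi> F \<cdot> b"
  using product assms unfolding kolmogorov_product_def by blast

lemma \<Phi>_nat_factor:
  assumes "e \<in> hom C E E'" "\<phi> \<in> hom C B (K \<odot> E)" "B \<in> Obj C" "E \<in> Obj C" "E' \<in> Obj C" "fin F"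
  shows "\<Phi> B E' ((Id C K \<otimes> e) \<cdot> \<phi>) F = (Id C (T F) \<otimes> e) \<cdot> \<Phi> B E \<phi> F"
  using product assms unfolding kolmogorov_product_def by blast

lemma \<Phi>_eq_univ:
  assumes "x \<in> Arr C" "Cod C x = K \<odot> E" "E \<in> Obj C" "fin F"
  shows "\<Phi> (Dom C x) E x F = univ E F \<cdot> x"
  using \<Phi>_nat_dom[of x "Dom C x" "K \<odot> E" "Id C (K \<odot> E)" E F] assms by (simp add: univ_def in_homI)

text \<open>The members of the universal family are deterministic because identities are.\<close>

lemma univ_family:
  assumes "E \<in> Obj C"
  shows "\<Phi> (K \<odot> E) E (Id C (K \<odot> E)) \<in> families C (Det C) J A (K \<odot> E) E"
  using bij_\<Phi>[of "K \<odot> E" E "Det C"] assms by (auto simp: bij_betw_def in_homI)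

lemma univ_arr [simp]:
  assumes "E \<in> Obj C" "fin F"
  shows "univ E F \<in> Det C" "univ E F \<in> Arr C" "Dom C (univ E F) = K \<odot> E" "Cod C (univ E F) = T F \<odot> E"
  using univ_family[OF assms(1)] assms(2) by (auto simp: families_def univ_def PiE_iff hom_def)

lemma univ_proj:
  assumes "E \<in> Obj C" "fin F" "F' \<subseteq> F"
  shows "(fin_proj C A F F' \<otimes> Id C E) \<cdot> univ E F = univ E F'"
  using univ_family[OF assms(1)] assms(2,3) by (auto simp: families_def univ_def)

lemma univ_nat:
  assumes "e \<in> Arr C" "fin F"
  shows "univ (Cod C e) F \<cdot> (Id C K \<otimes> e) = (Id C (T F) \<otimes> e) \<cdot> univ (Dom C e) F"
proof -
  let ?E = "Dom C e" and ?E' = "Cod C e"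
  have "\<Phi> (K \<odot> ?E) ?E' ((Id C K \<otimes> e) \<cdot> Id C (K \<odot> ?E)) F = (Id C (T F) \<otimes> e) \<cdot> univ ?E F"
    using assms \<Phi>_nat_factor[of e ?E ?E' "Id C (K \<odot> ?E)" "K \<odot> ?E" F] unfolding univ_def by (simp add: in_homI)
  then show ?thesis using assms \<Phi>_eq_univ[of "Id C K \<otimes> e" ?E' F] by simp
qed

text \<open>Injectivity of \<open>\<Phi>\<close>.\<close>

lemma univ_jointly_monic:
  assumes "x \<in> Arr C" "y \<in> Arr C" "Dom C x = Dom C y" "Cod C x = K \<odot> E" "Cod C y = K \<odot> E" "E \<in> Obj C"
    and eq: "\<And>F. fin F \<Longrightarrow> univ E F \<cdot> x = univ E F \<cdot> y"
  shows "x = y"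
proof -
  let ?B = "Dom C y"
  have bij: "bij_betw (\<Phi> ?B E) (hom C ?B (K \<odot> E) \<inter> Arr C) (families C (Arr C) J A ?B E)"
    using bij_\<Phi>[of ?B E "Arr C"] assms by simp
  have mem: "x \<in> hom C ?B (K \<odot> E) \<inter> Arr C" "y \<in> hom C ?B (K \<odot> E) \<inter> Arr C"
    using assms by (auto simp: hom_def)
  have "\<Phi> ?B E x F = \<Phi> ?B E y F" if "fin F" for F
    using \<Phi>_eq_univ[of x E F] \<Phi>_eq_univ[of y E F] eq[OF that] that assms by simp
  moreover have "\<Phi> ?B E x \<in> extensional (Fpow J)" "\<Phi> ?B E y \<in> extensional (Fpow J)"
    using bij_betwE[OF bij] mem by (auto simp: families_def PiE_def)
  ultimately have "\<Phi> ?B E x = \<Phi> ?B E y" by (meson extensionalityI)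
  then show ?thesis using bij mem by (auto simp: bij_betw_def inj_on_def)
qed

text \<open>Surjectivity of \<open>\<Phi>\<close>.\<close>

lemma univ_universal:
  assumes "B \<in> Obj C" "E \<in> Obj C" "X \<in> {Arr C, D, Det C}"
    and "\<And>F. fin F \<Longrightarrow> \<phi> F \<in> Arr C \<and> \<phi> F \<in> X \<and> Dom C (\<phi> F) = B \<and> Cod C (\<phi> F) = T F \<odot> E"
    and "\<And>F F'. fin F \<Longrightarrow> F' \<subseteq> F \<Longrightarrow> (fin_proj C A F F' \<otimes> Id C E) \<cdot> \<phi> F = \<phi> F'"
  obtains x where "x \<in> Arr C" "x \<in> X" "Dom C x = B" "Cod C x = K \<odot> E" "\<And>F. fin F \<Longrightarrow> univ E F \<cdot> x = \<phi> F"
proof -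
  let ?\<phi> = "restrict \<phi> (Fpow J)"
  have "?\<phi> \<in> families C X J A B E"
    using assms(4,5) by (auto simp: families_def hom_def intro: Fpow_mono)
  then obtain x where x: "x \<in> hom C B (K \<odot> E)" "x \<in> X" "\<Phi> B E x = ?\<phi>"
    using bij_\<Phi>[OF assms(1-3)] by (auto simp: bij_betw_def image_iff set_eq_iff) (metis IntE image_iff)
  show ?thesis
  proof (rule that)
    fix F assume F: "fin F"
    have "univ E F \<cdot> x = \<Phi> (Dom C x) E x F"
      using x F assms by (subst \<Phi>_eq_univ) (auto simp: hom_def)
    also have "\<dots> = \<phi> F" using x F by (auto simp: hom_def)
    finally show "univ E F \<cdot> x = \<phi> F" .
  qed (use x in \<open>auto simp: hom_def\<close>)
qed

abbreviation marg :: "nat set \<Rightarrow> 'm" where "marg F \<equiv> marginal C A K \<Phi> F"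

lemma marg_eq:
  assumes "fin F"
  shows "marg F = Runit C (T F) \<cdot> (univ (Unit C) F \<cdot> inv_arr C (Runit C K))"
  using \<Phi>_eq_univ[of "inv_arr C (Runit C K)" "Unit C" F] assms by (simp add: marginal_def)

lemma marg_arr [simp]:
  assumes "fin F"
  shows "marg F \<in> Det C" "marg F \<in> Arr C" "Dom C (marg F) = K" "Cod C (marg F) = T F"
  using assms by (simp_all add: marg_eq Det_inv_arr)

lemma Runit_inv_marg:
  assumes "fin F" "x \<in> Arr C" "Cod C x = K"
  shows "inv_arr C (Runit C (T F)) \<cdot> (marg F \<cdot> x) = univ (Unit C) F \<cdot> (inv_arr C (Runit C K) \<cdot> x)"
  using assms by (simp add: marg_eq)

lemma marg_proj:
  assumes F: "fin F" "F' \<subseteq> F"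
  shows "fin_proj C A F F' \<cdot> marg F = marg F'"
proof -
  have F': "fin F'" using F by (rule Fpow_mono)
  have "fin_proj C A F F' \<cdot> marg F =
      Runit C (T F') \<cdot> ((fin_proj C A F F' \<otimes> Id C (Unit C)) \<cdot> (univ (Unit C) F \<cdot> inv_arr C (Runit C K)))"
    using F F' comp_ext[OF Runit_nat[of "fin_proj C A F F'"], of "univ (Unit C) F \<cdot> inv_arr C (Runit C K)"]
    by (simp add: marg_eq)
  also have "\<dots> = marg F'"
    using F F' by (subst comp_ext[OF univ_proj]) (auto simp: marg_eq)
  finally show ?thesis .
qed

lemma marg_jointly_monic:
  assumes "x \<in> Arr C" "y \<in> Arr C" "Dom C x = Dom C y" "Cod C x = K" "Cod C y = K"
    and "\<And>F. fin F \<Longrightarrow> marg F \<cdot> x = marg F \<cdot> y"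
  shows "x = y"
proof -
  have "inv_arr C (Runit C K) \<cdot> x = inv_arr C (Runit C K) \<cdot> y"
  proof (rule univ_jointly_monic[where E = "Unit C"])
    fix F assume "fin F"
    then show "univ (Unit C) F \<cdot> (inv_arr C (Runit C K) \<cdot> x) = univ (Unit C) F \<cdot> (inv_arr C (Runit C K) \<cdot> y)"
      using assms Runit_inv_marg[of F x] Runit_inv_marg[of F y] by simp
  qed (use assms in auto)
  then have "Runit C K \<cdot> (inv_arr C (Runit C K) \<cdot> x) = Runit C K \<cdot> (inv_arr C (Runit C K) \<cdot> y)"
    by simp
  then show ?thesis using assms by simp
qed

text \<open>The universal property for \<open>E = I\<close>. The bijections then concern \<open>K \<odot> I\<close> instead of \<open>K\<close>, hence the unitors in
  the conditions on \<open>X\<close>.\<close>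

lemma marg_universal:
  assumes "B \<in> Obj C" "X \<in> {Arr C, D, Det C}"
    and \<phi>: "\<And>F. fin F \<Longrightarrow> \<phi> F \<in> Arr C \<and> inv_arr C (Runit C (T F)) \<cdot> \<phi> F \<in> X \<and> Dom C (\<phi> F) = B \<and> Cod C (\<phi> F) = T F"
    and proj: "\<And>F F'. fin F \<Longrightarrow> F' \<subseteq> F \<Longrightarrow> fin_proj C A F F' \<cdot> \<phi> F = \<phi> F'"
    and X: "\<And>x. x \<in> X \<Longrightarrow> x \<in> Arr C \<Longrightarrow> Cod C x = K \<odot> Unit C \<Longrightarrow> Runit C K \<cdot> x \<in> X"
  shows "\<exists>x \<in> Arr C \<inter> X. Dom C x = B \<and> Cod C x = K \<and> (\<forall>F. fin F \<longrightarrow> marg F \<cdot> x = \<phi> F)"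
proof -
  let ?I = "Unit C"
  have "(fin_proj C A F F' \<otimes> Id C ?I) \<cdot> (inv_arr C (Runit C (T F)) \<cdot> \<phi> F) = inv_arr C (Runit C (T F')) \<cdot> \<phi> F'"
    if "fin F" "F' \<subseteq> F" for F F'
    using that \<phi>[of F] Fpow_mono[OF that] comp_ext[OF Runit_inv_nat[of "fin_proj C A F F'"], of "\<phi> F"]
    by (simp add: proj[OF that, symmetric])
  then obtain x where x: "x \<in> Arr C" "x \<in> X" "Dom C x = B" "Cod C x = K \<odot> ?I"
      "\<And>F. fin F \<Longrightarrow> univ ?I F \<cdot> x = inv_arr C (Runit C (T F)) \<cdot> \<phi> F"
    using univ_universal[of B ?I X "\<lambda>F. inv_arr C (Runit C (T F)) \<cdot> \<phi> F"] assms(1,2) \<phi> by auto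
  show ?thesis
  proof (intro bexI[of _ "Runit C K \<cdot> x"] conjI allI impI)
    show "marg F \<cdot> (Runit C K \<cdot> x) = \<phi> F" if "fin F" for F
      using that x \<phi> by (simp add: marg_eq)
  qed (use x X in auto)
qed

section \<open>Marginalizations with an additional factor\<close>

text \<open>Write \<open>k\<close>, \<open>x\<close> for generic elements of \<open>K\<close>, \<open>E\<close>. The morphism \<open>u\<^sub>E\<^sub>,\<^sub>F\<close> is deterministic, so it is given by its
  marginals as \<open>(k, x) \<mapsto> (\<pi>\<^sub>F k, v\<^sub>E(k, x))\<close>, where \<open>v\<^sub>E : K \<odot> E \<rightarrow> E\<close> does not depend on \<open>F\<close>. Conversely, the family
  \<open>\<pi>\<^sub>F \<odot> id\<^sub>E\<close> factors through the universal one by a deterministic endomorphism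
  \<open>t\<^sub>E(k, x) = (k, s\<^sub>E(k, x))\<close> of \<open>K \<odot> E\<close>, and joint monicity of \<open>\<pi>\<^sub>F \<odot> id\<^sub>E\<close> amounts to monicity of \<open>t\<^sub>E\<close>. By construction
  \<open>s\<^sub>E(k, v\<^sub>E(k, x)) = x\<close>, which makes \<open>t\<^sub>E\<close> split epic. That it is also split monic uses naturality of
  \<open>s\<close> in \<open>E\<close> once for the morphism \<open>v\<^sub>E\<close> and once for the projections of \<open>K \<odot> E\<close>:
  \<open>x = s\<^sub>E(k, v\<^sub>E(k, x)) = v\<^sub>E(s\<^sub>K\<^sub>E(k, (k, x))) = v\<^sub>E(s\<^sub>K(k, k), s\<^sub>E(k, x))\<close>.
  The right-hand side is a function of \<open>t\<^sub>E(k, x)\<close>. In the lemmas below, \<open>t\<close>, \<open>s\<close> and \<open>v\<close> are \<open>twist\<close>, \<open>shear\<close> and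
  \<open>unshear\<close>. Since copying is not commutative, the order of the copies of \<open>k\<close> has to be tracked.\<close>

definition twist :: "'o \<Rightarrow> 'm" where
  "twist E = (SOME t. t \<in> Det C \<and> t \<in> Arr C \<and> Dom C t = K \<odot> E \<and> Cod C t = K \<odot> E \<and>
     (\<forall>F. fin F \<longrightarrow> univ E F \<cdot> t = marg F \<otimes> Id C E))"

lemma twist:
  assumes E: "E \<in> Obj C"
  shows "twist E \<in> Det C" "twist E \<in> Arr C" "Dom C (twist E) = K \<odot> E" "Cod C (twist E) = K \<odot> E"
    "\<And>F. fin F \<Longrightarrow> univ E F \<cdot> twist E = marg F \<otimes> Id C E"
proof -
  obtain t where "t \<in> Arr C" "t \<in> Det C" "Dom C t = K \<odot> E" "Cod C t = K \<odot> E"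
      "\<And>F. fin F \<Longrightarrow> univ E F \<cdot> t = marg F \<otimes> Id C E"
    using E by (rule_tac univ_universal[of "K \<odot> E" E "Det C" "\<lambda>F. marg F \<otimes> Id C E"]) (auto simp: marg_proj)
  then have "\<exists>t. t \<in> Det C \<and> t \<in> Arr C \<and> Dom C t = K \<odot> E \<and> Cod C t = K \<odot> E \<and>
     (\<forall>F. fin F \<longrightarrow> univ E F \<cdot> t = marg F \<otimes> Id C E)" by auto
  from someI_ex[OF this, folded twist_def]
  show "twist E \<in> Det C" "twist E \<in> Arr C" "Dom C (twist E) = K \<odot> E" "Cod C (twist E) = K \<odot> E"
    "\<And>F. fin F \<Longrightarrow> univ E F \<cdot> twist E = marg F \<otimes> Id C E" by auto
qed

lemmas twist_arr [simp] = twist(1-4)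

lemma twist_nat:
  assumes "e \<in> Arr C"
  shows "twist (Cod C e) \<cdot> (Id C K \<otimes> e) = (Id C K \<otimes> e) \<cdot> twist (Dom C e)"
proof (rule univ_jointly_monic[where E = "Cod C e"])
  fix F assume F: "fin F"
  have "univ (Cod C e) F \<cdot> (twist (Cod C e) \<cdot> (Id C K \<otimes> e)) = (Id C (T F) \<otimes> e) \<cdot> (marg F \<otimes> Id C (Dom C e))"
    using assms F comp_ext[OF twist(5)[of "Cod C e" F], of "Id C K \<otimes> e"] by simp
  also have "\<dots> = (Id C (T F) \<otimes> e) \<cdot> (univ (Dom C e) F \<cdot> twist (Dom C e))"
    using assms F by (simp add: twist(5) del: interchange)
  also have "\<dots> = univ (Cod C e) F \<cdot> ((Id C K \<otimes> e) \<cdot> twist (Dom C e))"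
    using assms F comp_ext[OF univ_nat[of e F], of "twist (Dom C e)"] by simp
  finally show "univ (Cod C e) F \<cdot> (twist (Cod C e) \<cdot> (Id C K \<otimes> e)) = univ (Cod C e) F \<cdot> ((Id C K \<otimes> e) \<cdot> twist (Dom C e))" .
qed (use assms in auto)

definition shear :: "'o \<Rightarrow> 'm" where "shear E = prr K E \<cdot> twist E"

lemma shear_arr [simp]:
  assumes "E \<in> Obj C"
  shows "shear E \<in> Det C" "shear E \<in> Arr C" "Dom C (shear E) = K \<odot> E" "Cod C (shear E) = E"
  using assms by (simp_all add: shear_def)

lemma shear_nat:
  assumes "e \<in> Arr C"
  shows "shear (Cod C e) \<cdot> (Id C K \<otimes> e) = e \<cdot> shear (Dom C e)"
  using assms comp_ext[OF prr_tensor[of "Id C K" e K "Cod C e"], of "twist (Dom C e)"]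
  by (simp add: shear_def twist_nat)

text \<open>Naturality for the morphism \<open>del\<^sub>E\<close>.\<close>

lemma prl_univ:
  assumes "E \<in> Obj C" "fin F"
  shows "prl (T F) E \<cdot> univ E F = marg F \<cdot> prl K E"
  using assms univ_nat[of "Del C E" F] by (simp add: prl_def marg_eq)

lemma prl_twist:
  assumes E: "E \<in> Obj C"
  shows "prl K E \<cdot> twist E = prl K E"
proof (rule marg_jointly_monic)
  fix F assume F: "fin F"
  have "marg F \<cdot> (prl K E \<cdot> twist E) = prl (T F) E \<cdot> (univ E F \<cdot> twist E)"
    using E F comp_ext[OF prl_univ[OF E F, symmetric], of "twist E"] by simp
  also have "\<dots> = marg F \<cdot> prl K E"
    using E F by (simp add: twist(5) prl_tensor)
  finally show "marg F \<cdot> (prl K E \<cdot> twist E) = marg F \<cdot> prl K E" .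
qed (use E in auto)

lemma twist_eq_pair:
  assumes "E \<in> Obj C"
  shows "\<langle>prl K E, shear E\<rangle> = twist E" "Swap C E K \<cdot> \<langle>shear E, prl K E\<rangle> = twist E"
  using Det_eq_pair[of "twist E" K E] assms by (simp_all add: prl_twist shear_def)

definition unshear :: "'o \<Rightarrow> 'm" where "unshear E = Lunit C E \<cdot> univ E {}"

lemma unshear_arr [simp]:
  assumes "E \<in> Obj C"
  shows "unshear E \<in> Arr C" "Dom C (unshear E) = K \<odot> E" "Cod C (unshear E) = E"
  using assms by (simp_all add: unshear_def)

lemma univ_eq:
  assumes E: "E \<in> Obj C" and F: "fin F"
  shows "univ E F = (marg F \<otimes> Id C E) \<cdot> \<langle>prl K E, unshear E\<rangle>"
proof -
  have "fin_proj C A F {} = Del C (T F)"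
    using F terminal_Unit[of "fin_proj C A F {}"] by simp
  then have "prr (T F) E \<cdot> univ E F = unshear E"
    using E F univ_proj[of E F "{}"] by (simp add: prr_def unshear_def)
  then have "\<langle>marg F \<cdot> prl K E, unshear E\<rangle> = univ E F"
    using Det_eq_pair(1)[of "univ E F" "T F" E] E F by (simp add: prl_univ)
  then show ?thesis using E F by simp
qed

lemma twist_unshear:
  assumes E: "E \<in> Obj C"
  shows "twist E \<cdot> \<langle>prl K E, unshear E\<rangle> = Id C (K \<odot> E)"
proof (rule univ_jointly_monic[OF _ _ _ _ _ E])
  fix F assume F: "fin F"
  show "univ E F \<cdot> (twist E \<cdot> \<langle>prl K E, unshear E\<rangle>) = univ E F \<cdot> Id C (K \<odot> E)"
    using E F comp_ext[OF twist(5)[OF E F], of "\<langle>prl K E, unshear E\<rangle>"] univ_eq[OF E F] by simp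
qed (use E in auto)

text \<open>The marginals of \<open>s\<^sub>K\<^sub>E\<close> are known by naturality, and as it is deterministic they may be paired in reversed
  order. In that order, only a copy of \<open>k\<close> and \<open>x\<close>, which are compatible, have to pass each other, and never
  two copies of \<open>k\<close>. The result is \<open>s\<^sub>K\<^sub>E(k, (k, x)) = (s\<^sub>K(k, k), s\<^sub>E(k, x))\<close>.\<close>

lemma shear_shear:
  assumes E: "E \<in> Obj C"
  shows "shear (K \<odot> E) \<cdot> \<langle>prl K E, Id C (K \<odot> E)\<rangle> = ((shear K \<cdot> Copy C K) \<otimes> Id C E) \<cdot> twist E"
proof -
  let ?p = "prl K E" and ?q = "prr K E"
  have sw: "Swap C K E \<cdot> \<langle>?p, ?q\<rangle> = \<langle>?q, ?p\<rangle>"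
    using E Det_eq_pair(2)[of "Id C (K \<odot> E)" K E] pair_pr[of K E] Swap_pair_flip[of ?q ?p] by simp
  have "?q \<cdot> shear (K \<odot> E) = shear E \<cdot> (Id C K \<otimes> ?q)" "?p \<cdot> shear (K \<odot> E) = shear K \<cdot> (Id C K \<otimes> ?p)"
    using E shear_nat[of ?q] shear_nat[of ?p] by simp_all
  then have "shear (K \<odot> E) = Swap C E K \<cdot> \<langle>shear E \<cdot> (Id C K \<otimes> ?q), shear K \<cdot> (Id C K \<otimes> ?p)\<rangle>"
    using E Det_eq_pair(2)[of "shear (K \<odot> E)" K E] by simp
  also have "\<langle>shear E \<cdot> (Id C K \<otimes> ?q), shear K \<cdot> (Id C K \<otimes> ?p)\<rangle> =
      (shear E \<otimes> shear K) \<cdot> (mid4 C K K E K \<cdot> (\<langle>Id C K, Id C K\<rangle> \<otimes> \<langle>?q, ?p\<rangle>))"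
    using E pair_tensor[of "Id C K" ?q "Id C K" ?p] tensor_pair[of "Id C K \<otimes> ?q" "Id C K \<otimes> ?p" "shear E" "shear K"]
    by (simp del: tensor_pair)
  finally have "shear (K \<odot> E) \<cdot> \<langle>?p, Id C (K \<odot> E)\<rangle> =
      Swap C E K \<cdot> ((shear E \<otimes> shear K) \<cdot> (mid4 C K K E K \<cdot> \<langle>\<langle>?p, ?p\<rangle>, \<langle>?q, ?p\<rangle>\<rangle>))"
    using E by (simp add: pair_Det)
  also have "\<dots> = Swap C E K \<cdot> ((shear E \<otimes> shear K) \<cdot> \<langle>\<langle>?p, ?q\<rangle>, \<langle>?p, ?p\<rangle>\<rangle>)"
    using E sw mid4_pair[of ?p ?p ?q ?p "K \<odot> E"] by simp
  also have "\<dots> = Swap C E K \<cdot> \<langle>shear E, (shear K \<cdot> Copy C K) \<cdot> ?p\<rangle>"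
    using E Det_Copy[of ?p] by (simp add: pair_pr)
  also have "\<dots> = Swap C E K \<cdot> ((Id C E \<otimes> (shear K \<cdot> Copy C K)) \<cdot> \<langle>shear E, ?p\<rangle>)"
    using E by simp
  also have "\<dots> = ((shear K \<cdot> Copy C K) \<otimes> Id C E) \<cdot> (Swap C E K \<cdot> \<langle>shear E, ?p\<rangle>)"
    using E comp_ext[OF Swap_nat[of "Id C E" "shear K \<cdot> Copy C K"], of "\<langle>shear E, ?p\<rangle>"] by (simp del: tensor_pair)
  finally show ?thesis using E by (simp add: twist_eq_pair)
qed

lemma twist_split_monic:
  assumes E: "E \<in> Obj C"
  obtains r where "r \<in> Arr C" "Dom C r = K \<odot> E" "Cod C r = K \<odot> E" "r \<cdot> twist E = Id C (K \<odot> E)"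
proof -
  let ?p = "prl K E" and ?q = "prr K E" and ?L = "unshear E \<cdot> ((shear K \<cdot> Copy C K) \<otimes> Id C E)"
  \<comment> \<open>The second projection is a function of \<open>twist E\<close>.\<close>
  have "?q = shear E \<cdot> \<langle>?p, unshear E\<rangle>"
    using E by (simp add: shear_def twist_unshear)
  also have "\<dots> = (shear E \<cdot> (Id C K \<otimes> unshear E)) \<cdot> \<langle>?p, Id C (K \<odot> E)\<rangle>"
    using E by simp
  also have "\<dots> = unshear E \<cdot> (shear (K \<odot> E) \<cdot> \<langle>?p, Id C (K \<odot> E)\<rangle>)"
    using E shear_nat[of "unshear E"] by simp
  also have "\<dots> = ?L \<cdot> twist E" using E by (simp add: shear_shear)
  finally have q: "?q = ?L \<cdot> twist E" .
  \<comment> \<open>Duplicating the first entry of \<open>twist E\<close> keeps \<open>k\<close> available after \<open>x\<close> has been recovered.\<close>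
  have "\<langle>?p, twist E\<rangle> = Assoc C K K E \<cdot> \<langle>\<langle>?p, ?p\<rangle>, shear E\<rangle>"
    using E by (simp add: twist_eq_pair)
  also have "\<dots> = (Assoc C K K E \<cdot> (Copy C K \<otimes> Id C E)) \<cdot> \<langle>?p, shear E\<rangle>"
    using E Det_Copy[of ?p] by simp
  finally have pt: "\<langle>?p, twist E\<rangle> = (Assoc C K K E \<cdot> (Copy C K \<otimes> Id C E)) \<cdot> twist E"
    using E by (simp add: twist_eq_pair)
  have "Id C (K \<odot> E) = \<langle>?p, ?L \<cdot> twist E\<rangle>"
    using E pair_pr[of K E] by (simp flip: q)
  also have "\<dots> = (Id C K \<otimes> ?L) \<cdot> \<langle>?p, twist E\<rangle>" using E by simp
  also have "\<dots> = ((Id C K \<otimes> ?L) \<cdot> (Assoc C K K E \<cdot> (Copy C K \<otimes> Id C E))) \<cdot> twist E"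
    unfolding pt using E by simp
  finally show ?thesis
    using that[of "(Id C K \<otimes> ?L) \<cdot> (Assoc C K K E \<cdot> (Copy C K \<otimes> Id C E))"] E by simp
qed

lemma marg_tensor_jointly_monic:
  assumes xy: "x \<in> Arr C" "y \<in> Arr C" "Dom C x = Dom C y" "Cod C x = K \<odot> E" "Cod C y = K \<odot> E" and E: "E \<in> Obj C"
    and eq: "\<And>F. fin F \<Longrightarrow> (marg F \<otimes> Id C E) \<cdot> x = (marg F \<otimes> Id C E) \<cdot> y"
  shows "x = y"
proof -
  have "twist E \<cdot> x = twist E \<cdot> y"
  proof (rule univ_jointly_monic[OF _ _ _ _ _ E])
    fix F assume "fin F"
    then show "univ E F \<cdot> (twist E \<cdot> x) = univ E F \<cdot> (twist E \<cdot> y)"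
      using xy E eq comp_ext[OF twist(5)[of E F], of x] comp_ext[OF twist(5)[of E F], of y] by simp
  qed (use xy E in auto)
  moreover obtain r where r: "r \<in> Arr C" "Dom C r = K \<odot> E" "Cod C r = K \<odot> E" "r \<cdot> twist E = Id C (K \<odot> E)"
    using twist_split_monic[OF E] .
  moreover have "r \<cdot> (twist E \<cdot> x) = x" "r \<cdot> (twist E \<cdot> y) = y"
    using xy E r(1-3) by (subst comp_ext[OF r(4)], auto)+
  ultimately show ?thesis by metis
qed

text \<open>Joint monicity is used twice, for either factor \<open>K\<close>, with a swap in between.\<close>

lemma marg_tensor_marg_jointly_monic:
  assumes xy: "x \<in> Arr C" "y \<in> Arr C" "Dom C x = Dom C y" "Cod C x = K \<odot> K" "Cod C y = K \<odot> K"
    and eq: "\<And>F G. fin F \<Longrightarrow> fin G \<Longrightarrow> (marg F \<otimes> marg G) \<cdot> x = (marg F \<otimes> marg G) \<cdot> y"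
  shows "x = y"
proof (rule marg_tensor_jointly_monic[where E = K])
  fix F assume F: "fin F"
  have sw: "(marg G \<otimes> Id C (T F)) \<cdot> (Swap C (T F) K \<cdot> ((marg F \<otimes> Id C K) \<cdot> z)) =
      Swap C (T F) (T G) \<cdot> ((marg F \<otimes> marg G) \<cdot> z)"
    if "fin G" "z \<in> Arr C" "Cod C z = K \<odot> K" for G z
    using that F comp_ext[OF Swap_nat[of "Id C (T F)" "marg G"], of "(marg F \<otimes> Id C K) \<cdot> z"] by simp
  have "Swap C (T F) K \<cdot> ((marg F \<otimes> Id C K) \<cdot> x) = Swap C (T F) K \<cdot> ((marg F \<otimes> Id C K) \<cdot> y)"
  proof (rule marg_tensor_jointly_monic[where E = "T F"])
    fix G assume G: "fin G"
    show "(marg G \<otimes> Id C (T F)) \<cdot> (Swap C (T F) K \<cdot> ((marg F \<otimes> Id C K) \<cdot> x)) =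
        (marg G \<otimes> Id C (T F)) \<cdot> (Swap C (T F) K \<cdot> ((marg F \<otimes> Id C K) \<cdot> y))"
      by (simp only: sw[OF G xy(1,4)] sw[OF G xy(2,5)] eq[OF F G])
  qed (use xy F in auto)
  then show "(marg F \<otimes> Id C K) \<cdot> x = (marg F \<otimes> Id C K) \<cdot> y"
    by (rule iso_cancel_left) (use xy F in auto)
qed (use xy in auto)

end

section \<open>Powers of a morphism\<close>

primrec tensor_power :: "('o, 'm, 'x) monoidal_data_scheme \<Rightarrow> 'o \<Rightarrow> nat \<Rightarrow> 'o" where
  "tensor_power C X 0 = Unit C"
| "tensor_power C X (Suc n) = tensor_power C X n \<odot>\<^bsub>C\<^esub> X"

lemma tensor_list_const [simp]: "tensor_list C (\<lambda>_. X) js = tensor_power C X (length js)"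
  by (induction js) auto

context symmetric_monoidal_category
begin

lemma tensor_power_Obj [simp]: "X \<in> Obj C \<Longrightarrow> tensor_power C X n \<in> Obj C"
  by (induction n) auto

end

context involutive_markov_category
begin

lemma pair_power_arr [simp]:
  assumes "f \<in> Arr C"
  shows "pair_power C f n \<in> Arr C" "Dom C (pair_power C f n) = Dom C f"
    "Cod C (pair_power C f n) = tensor_power C (Cod C f) n"
proof -
  have "pair_power C f n \<in> Arr C \<and> Dom C (pair_power C f n) = Dom C f \<and>
    Cod C (pair_power C f n) = tensor_power C (Cod C f) n"
    using assms by (induction n) auto
  then show "pair_power C f n \<in> Arr C" "Dom C (pair_power C f n) = Dom C f"
    "Cod C (pair_power C f n) = tensor_power C (Cod C f) n" by auto
qed

lemma pair_power_Det:
  assumes "f \<in> Arr C" "g \<in> Det C" "Cod C g = Dom C f"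
  shows "pair_power C f n \<cdot> g = pair_power C (f \<cdot> g) n"
  using assms Det_arr[OF assms(2)] by (induction n) (auto simp: pair_Det)

lemma pair_power_1:
  assumes "f \<in> Arr C"
  shows "Lunit C (Cod C f) \<cdot> pair_power C f 1 = f"
  using assms by simp

text \<open>The same structural morphism splits the powers of all \<open>f\<close>, so an equation between powers of different
  morphisms yields one between pairs of powers.\<close>

lemma pair_power_split:
  assumes X: "X \<in> Obj C"
  shows "\<exists>s \<in> Arr C. Dom C s = tensor_power C X (m + n) \<and>
    (\<forall>f. f \<in> Arr C \<and> Cod C f = X \<longrightarrow> s \<cdot> pair_power C f (m + n) = \<langle>pair_power C f m, pair_power C f n\<rangle>)"
proof -
  have "\<exists>s \<in> Arr C. Dom C s = tensor_power C X (m + n) \<and> Cod C s = tensor_power C X m \<odot> tensor_power C X n \<and>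
    (\<forall>f. f \<in> Arr C \<and> Cod C f = X \<longrightarrow> s \<cdot> pair_power C f (m + n) = \<langle>pair_power C f m, pair_power C f n\<rangle>)"
  proof (induction n)
    case 0
    let ?r = "Runit C (tensor_power C X m)"
    have "inv_arr C ?r \<cdot> pair_power C f m = \<langle>pair_power C f m, Del C (Dom C f)\<rangle>"
      if "f \<in> Arr C" "Cod C f = X" for f
      by (rule iso_cancel_left[where f = ?r]) (use that X in auto)
    then show ?case using X by (intro bexI[of _ "inv_arr C ?r"]) auto
  next
    case (Suc n)
    then obtain s where s: "s \<in> Arr C" "Dom C s = tensor_power C X (m + n)"
      "Cod C s = tensor_power C X m \<odot> tensor_power C X n"
      "\<forall>f. f \<in> Arr C \<and> Cod C f = X \<longrightarrow> s \<cdot> pair_power C f (m + n) = \<langle>pair_power C f m, pair_power C f n\<rangle>"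
      by blast
    show ?case
      using X s by (intro bexI[of _ "Assoc C (tensor_power C X m) (tensor_power C X n) X \<cdot> (s \<otimes> Id C X)"]) auto
  qed
  then show ?thesis by blast
qed

lemma compatibleD:
  assumes "compatible C f g"
  shows "f \<in> Arr C" "g \<in> Arr C" "Dom C f = Dom C g" "Swap C (Cod C g) (Cod C f) \<cdot> \<langle>g, f\<rangle> = \<langle>f, g\<rangle>"
  using assms by (auto simp: compatible_def)

lemma compatible_sym: "compatible C f g \<Longrightarrow> compatible C g f"
  using Swap_pair_flip[of g f] by (auto simp: compatible_def)

lemma compatible_Del:
  assumes "f \<in> Arr C"
  shows "compatible C (Del C (Dom C f)) f"
proof -
  have "\<langle>Del C (Dom C f), f\<rangle> = Swap C (Cod C f) (Unit C) \<cdot> \<langle>f, Del C (Dom C f)\<rangle>"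
    by (rule iso_cancel_left[where f = "Lunit C (Cod C f)"])
      (use assms comp_ext[OF Lunit_Swap[of "Cod C f"], of "\<langle>f, Del C (Dom C f)\<rangle>"] in auto)
  then show ?thesis using assms by (simp add: compatible_def)
qed

text \<open>The hexagon moves \<open>h\<close> past \<open>f\<close> and \<open>g\<close> one at a time.\<close>

lemma compatible_pair:
  assumes f: "compatible C f h" and g: "compatible C g h"
  shows "compatible C \<langle>f, g\<rangle> h"
proof -
  note a = compatibleD[OF f] compatibleD[OF g]
  let ?A = "Cod C h" and ?B = "Cod C f" and ?E = "Cod C g"
  have "Assoc C ?B ?E ?A \<cdot> (Swap C ?A (?B \<odot> ?E) \<cdot> \<langle>h, \<langle>f, g\<rangle>\<rangle>) =
      (Assoc C ?B ?E ?A \<cdot> Swap C ?A (?B \<odot> ?E) \<cdot> Assoc C ?A ?B ?E) \<cdot> \<langle>\<langle>h, f\<rangle>, g\<rangle>"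
    using a by simp
  also have "\<dots> = Assoc C ?B ?E ?A \<cdot> \<langle>\<langle>f, g\<rangle>, h\<rangle>"
    using a by (subst hexagon) auto
  finally have "Swap C ?A (?B \<odot> ?E) \<cdot> \<langle>h, \<langle>f, g\<rangle>\<rangle> = \<langle>\<langle>f, g\<rangle>, h\<rangle>"
    by (rule iso_cancel_left) (use a in auto)
  then show ?thesis using a by (simp add: compatible_def)
qed

lemma compatible_power:
  assumes "compatible C f g"
  shows "compatible C (pair_power C f n) g"
  using assms compatibleD[OF assms] compatible_Del[of g] by (induction n) (auto intro: compatible_pair)

lemma compatible_powers:
  assumes "compatible C f f"
  shows "compatible C (pair_power C f m) (pair_power C f n)"
  using assms by (blast intro: compatible_power compatible_sym)

lemma classical_compatible:
  assumes "classical C B" "f \<in> Arr C" "Dom C f = B"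
  shows "compatible C f f"
proof -
  have [simp]: "B \<in> Obj C" using assms(1) by (simp add: classical_def)
  have "Swap C (Cod C f) (Cod C f) \<cdot> \<langle>f, f\<rangle> = (f \<otimes> f) \<cdot> (Swap C B B \<cdot> Copy C B)"
    using assms comp_ext[OF Swap_nat[of f f], of "Copy C B"] by (simp add: pair_def)
  then show ?thesis using assms by (simp add: compatible_def pair_def classical_def)
qed

lemma proj_list_power:
  assumes "f \<in> Arr C"
  shows "proj_list C (\<lambda>_. Cod C f) F' js \<cdot> pair_power C f (length js) = pair_power C f (length (filter (\<lambda>i. i \<in> F') js))"
  using assms by (induction js) auto

section \<open>Permutations of tensor factors\<close>

text \<open>The exchange of the last two factors, of which \<open>move_last\<close> is composed.\<close>

definition swap_last :: "'o \<Rightarrow> 'o \<Rightarrow> 'o \<Rightarrow> 'm" where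
  "swap_last X Y Z = inv_arr C (Assoc C X Z Y) \<cdot> ((Id C X \<otimes> Swap C Y Z) \<cdot> Assoc C X Y Z)"

lemma swap_last_arr [simp]:
  assumes "X \<in> Obj C" "Y \<in> Obj C" "Z \<in> Obj C"
  shows "swap_last X Y Z \<in> Arr C" "Dom C (swap_last X Y Z) = (X \<odot> Y) \<odot> Z" "Cod C (swap_last X Y Z) = (X \<odot> Z) \<odot> Y"
  using assms by (simp_all add: swap_last_def)

lemma swap_last_nat:
  assumes "f \<in> Arr C" "g \<in> Arr C" "h \<in> Arr C"
  shows "((f \<otimes> h) \<otimes> g) \<cdot> swap_last (Dom C f) (Dom C g) (Dom C h) =
    swap_last (Cod C f) (Cod C g) (Cod C h) \<cdot> ((f \<otimes> g) \<otimes> h)"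
proof -
  let ?a = "Assoc C (Dom C f) (Dom C g) (Dom C h)" and ?b' = "inv_arr C (Assoc C (Cod C f) (Cod C h) (Cod C g))"
  have "((f \<otimes> h) \<otimes> g) \<cdot> swap_last (Dom C f) (Dom C g) (Dom C h) =
      ?b' \<cdot> ((f \<otimes> (h \<otimes> g)) \<cdot> ((Id C (Dom C f) \<otimes> Swap C (Dom C g) (Dom C h)) \<cdot> ?a))"
    unfolding swap_last_def using assms by (subst comp_ext[OF Assoc_inv_nat[symmetric]]) auto
  also have "\<dots> = ?b' \<cdot> ((f \<otimes> (Swap C (Cod C g) (Cod C h) \<cdot> (g \<otimes> h))) \<cdot> ?a)"
    using assms by (simp add: Swap_nat)
  also have "\<dots> = ?b' \<cdot> ((Id C (Cod C f) \<otimes> Swap C (Cod C g) (Cod C h)) \<cdot> ((f \<otimes> (g \<otimes> h)) \<cdot> ?a))"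
    using assms by simp
  also have "\<dots> = swap_last (Cod C f) (Cod C g) (Cod C h) \<cdot> ((f \<otimes> g) \<otimes> h)"
    using assms by (simp add: swap_last_def Assoc_nat)
  finally show ?thesis .
qed

lemma swap_last_Unit:
  assumes X: "X \<in> Obj C" and Y: "Y \<in> Obj C"
  shows "(Runit C X \<otimes> Id C Y) \<cdot> swap_last X Y (Unit C) = Runit C (X \<odot> Y)"
    and "Runit C (X \<odot> Y) \<cdot> swap_last X (Unit C) Y = Runit C X \<otimes> Id C Y"
proof -
  show "(Runit C X \<otimes> Id C Y) \<cdot> swap_last X Y (Unit C) = Runit C (X \<odot> Y)"
    unfolding swap_last_def using X Y by (subst comp_ext[OF triangle_inv]) (auto simp: Lunit_Swap Runit_tensor)
  show "Runit C (X \<odot> Y) \<cdot> swap_last X (Unit C) Y = Runit C X \<otimes> Id C Y"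
    unfolding swap_last_def using X Y by (subst comp_ext[OF Runit_tensor_inv]) (auto simp: Runit_Swap triangle)
qed

lemma swap_last_pair:
  assumes "a \<in> Arr C" "Dom C a = Dom C b" "compatible C c b"
  shows "swap_last (Cod C a) (Cod C b) (Cod C c) \<cdot> \<langle>\<langle>a, b\<rangle>, c\<rangle> = \<langle>\<langle>a, c\<rangle>, b\<rangle>"
  using assms(1,2) compatibleD[OF assms(3)] by (simp add: swap_last_def)

lemma move_last_arr [simp]:
  assumes "\<forall>j \<in> set js. A j \<in> Obj C" "k \<in> set js"
  shows "move_last C A k js \<in> Arr C" "Dom C (move_last C A k js) = tensor_list C A js"
    "Cod C (move_last C A k js) = tensor_list C A (remove1 k js) \<odot> A k"
proof -
  have "move_last C A k js \<in> Arr C \<and> Dom C (move_last C A k js) = tensor_list C A js \<and>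
    Cod C (move_last C A k js) = tensor_list C A (remove1 k js) \<odot> A k"
    using assms
  proof (induction js)
    case (Cons j js)
    moreover have "tensor_list C A (remove1 k js) \<in> Obj C"
      using Cons.prems set_remove1_subset[of k js] by (intro tensor_list_Obj) auto
    ultimately show ?case by (auto simp: Let_def)
  qed simp
  then show "move_last C A k js \<in> Arr C" "Dom C (move_last C A k js) = tensor_list C A js"
    "Cod C (move_last C A k js) = tensor_list C A (remove1 k js) \<odot> A k" by auto
qed

lemma reorder_arr [simp]:
  assumes "distinct js" "distinct ks" "set js = set ks" "\<forall>j \<in> set ks. A j \<in> Obj C"
  shows "reorder C A js ks \<in> Arr C" "Dom C (reorder C A js ks) = tensor_list C A js"
    "Cod C (reorder C A js ks) = tensor_list C A ks"
proof -
  have "reorder C A js ks \<in> Arr C \<and> Dom C (reorder C A js ks) = tensor_list C A js \<and>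
    Cod C (reorder C A js ks) = tensor_list C A ks"
    using assms
  proof (induction ks arbitrary: js)
    case (Cons k ks)
    have "set (remove1 k js) = set ks" using Cons.prems by auto
    then show ?case using Cons.prems Cons.IH[of "remove1 k js"] by simp
  qed simp
  then show "reorder C A js ks \<in> Arr C" "Dom C (reorder C A js ks) = tensor_list C A js"
    "Cod C (reorder C A js ks) = tensor_list C A ks" by auto
qed

lemma move_last_Cons:
  assumes "k \<in> set js" "i \<noteq> k" "\<forall>j \<in> set js. A j \<in> Obj C" "A i \<in> Obj C"
  shows "move_last C A k (i # js) =
    swap_last (tensor_list C A (remove1 k js)) (A k) (A i) \<cdot> (move_last C A k js \<otimes> Id C (A i))"
proof -
  have "tensor_list C A (remove1 k js) \<in> Obj C"
    using assms set_remove1_subset[of k js] by (intro tensor_list_Obj) auto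
  then show ?thesis using assms by (simp add: Let_def swap_last_def)
qed

text \<open>Moving a factor to the end commutes with deleting other factors. In the induction, a deleted factor that
  has to be passed has become the unit object, and swapping with the unit is absorbed by unitors.\<close>

lemma proj_move_last_in:
  assumes "distinct js" "k \<in> set js" "k \<in> F'" "\<forall>j \<in> set js. A j \<in> Obj C"
  shows "(proj_list C A F' (remove1 k js) \<otimes> Id C (A k)) \<cdot> move_last C A k js =
    move_last C A k (filter (\<lambda>i. i \<in> F') js) \<cdot> proj_list C A F' js"
  using assms
proof (induction js)
  case (Cons i js)
  show ?case
  proof (cases "i = k")
    case True
    then show ?thesis using Cons.prems by simp
  next
    case False
    let ?f = "filter (\<lambda>i. i \<in> F')"
    let ?js = "remove1 k js"
    let ?P = "proj_list C A F' ?js" and ?M = "move_last C A k js" and ?M' = "move_last C A k (?f js)"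
    let ?X = "tensor_list C A (remove1 k (?f js))" and ?Y = "tensor_list C A ?js"
    have k: "k \<in> set js" "k \<in> set (?f js)" and obj: "A i \<in> Obj C" "A k \<in> Obj C" "\<forall>j \<in> set js. A j \<in> Obj C"
      "\<forall>j \<in> set ?js. A j \<in> Obj C" "\<forall>j \<in> set (?f js). A j \<in> Obj C"
      using Cons.prems False set_remove1_subset[of k js] by auto
    have IH: "(?P \<otimes> Id C (A k)) \<cdot> ?M = ?M' \<cdot> proj_list C A F' js"
      using Cons k by auto
    have fr: "?f ?js = remove1 k (?f js)" by (rule filter_remove1)
    have P: "?P \<in> Arr C" "Dom C ?P = ?Y" "Cod C ?P = ?X" using obj fr by simp_all
    then have X: "?X \<in> Obj C" "?Y \<in> Obj C" by (metis Dom_Cod_Obj)+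
    show ?thesis
    proof (cases "i \<in> F'")
      case True
      have "((?P \<otimes> Id C (A i)) \<otimes> Id C (A k)) \<cdot> (swap_last ?Y (A k) (A i) \<cdot> (?M \<otimes> Id C (A i))) =
          swap_last ?X (A k) (A i) \<cdot> ((?P \<otimes> Id C (A k) \<cdot> ?M) \<otimes> Id C (A i))"
        using comp_ext[OF swap_last_nat[of ?P "Id C (A k)" "Id C (A i)"], of "?M \<otimes> Id C (A i)"] P X obj k by simp
      then show ?thesis
        using True False IH P X obj k by (simp add: move_last_Cons del: move_last.simps)
    next
      case F: False
      have "((Runit C ?X \<cdot> (?P \<otimes> Del C (A i))) \<otimes> Id C (A k)) \<cdot> (swap_last ?Y (A k) (A i) \<cdot> (?M \<otimes> Id C (A i))) =
          (Runit C ?X \<otimes> Id C (A k)) \<cdot> ((((?P \<otimes> Del C (A i)) \<otimes> Id C (A k)) \<cdot> swap_last ?Y (A k) (A i)) \<cdot> (?M \<otimes> Id C (A i)))"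
        using P X obj k by simp
      also have "\<dots> = (Runit C ?X \<otimes> Id C (A k)) \<cdot> (swap_last ?X (A k) (Unit C) \<cdot> ((?M' \<cdot> proj_list C A F' js) \<otimes> Del C (A i)))"
        using swap_last_nat[of ?P "Id C (A k)" "Del C (A i)"] P X obj k by (simp add: IH)
      also have "\<dots> = Runit C (?X \<odot> A k) \<cdot> ((?M' \<otimes> Id C (Unit C)) \<cdot> (proj_list C A F' js \<otimes> Del C (A i)))"
        using X obj k by (subst comp_ext[OF swap_last_Unit(1)]) auto
      also have "\<dots> = ?M' \<cdot> proj_list C A F' (i # js)"
        using F X obj k comp_ext[OF Runit_nat[of ?M'], of "proj_list C A F' js \<otimes> Del C (A i)"]
        by (simp del: interchange)
      finally show ?thesis
        using F False P X obj k by (simp add: move_last_Cons fr del: move_last.simps)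
    qed
  qed
qed simp

text \<open>The complementary case: the moved factor is itself deleted, and becomes the unit object that the retained
  factors have to pass.\<close>

lemma proj_move_last_out:
  assumes "distinct js" "k \<in> set js" "k \<notin> F'" "\<forall>j \<in> set js. A j \<in> Obj C"
  shows "Runit C (tensor_list C A (filter (\<lambda>i. i \<in> F') js)) \<cdot>
    ((proj_list C A F' (remove1 k js) \<otimes> Del C (A k)) \<cdot> move_last C A k js) = proj_list C A F' js"
  using assms
proof (induction js)
  case (Cons i js)
  show ?case
  proof (cases "i = k")
    case True
    then show ?thesis using Cons.prems by simp
  next
    case False
    let ?f = "filter (\<lambda>i. i \<in> F')"
    let ?js = "remove1 k js"
    let ?P = "proj_list C A F' ?js" and ?M = "move_last C A k js"
    let ?X = "tensor_list C A (?f js)" and ?Y = "tensor_list C A ?js"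
    have k: "k \<in> set js" and obj: "A i \<in> Obj C" "A k \<in> Obj C" "\<forall>j \<in> set js. A j \<in> Obj C"
      "\<forall>j \<in> set ?js. A j \<in> Obj C" "\<forall>j \<in> set (?f js). A j \<in> Obj C"
      using Cons.prems False set_remove1_subset[of k js] by auto
    have IH: "Runit C ?X \<cdot> ((?P \<otimes> Del C (A k)) \<cdot> ?M) = proj_list C A F' js"
      using Cons k by auto
    have fr: "?f ?js = ?f js" using Cons.prems(3) by (simp add: filter_remove1 remove1_idem)
    have P: "?P \<in> Arr C" "Dom C ?P = ?Y" "Cod C ?P = ?X" using obj fr by simp_all
    then have X: "?X \<in> Obj C" "?Y \<in> Obj C" by (metis Dom_Cod_Obj)+
    show ?thesis
    proof (cases "i \<in> F'")
      case True
      have "Runit C (?X \<odot> A i) \<cdot> (((?P \<otimes> Id C (A i)) \<otimes> Del C (A k)) \<cdot> (swap_last ?Y (A k) (A i) \<cdot> (?M \<otimes> Id C (A i)))) =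
          Runit C (?X \<odot> A i) \<cdot> (swap_last ?X (Unit C) (A i) \<cdot> (((?P \<otimes> Del C (A k)) \<cdot> ?M) \<otimes> Id C (A i)))"
        using comp_ext[OF swap_last_nat[of ?P "Del C (A k)" "Id C (A i)"], of "?M \<otimes> Id C (A i)"] P X obj k by simp
      also have "\<dots> = (Runit C ?X \<cdot> ((?P \<otimes> Del C (A k)) \<cdot> ?M)) \<otimes> Id C (A i)"
        using P X obj k by (subst comp_ext[OF swap_last_Unit(2)]) auto
      finally show ?thesis
        using True False IH P X obj k by (simp add: move_last_Cons del: move_last.simps)
    next
      case F: False
      let ?Z = "(?P \<otimes> Del C (A k)) \<cdot> ?M" and ?I = "Unit C"
      have "((Runit C ?X \<cdot> (?P \<otimes> Del C (A i))) \<otimes> Del C (A k)) \<cdot> (swap_last ?Y (A k) (A i) \<cdot> (?M \<otimes> Id C (A i))) =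
          (Runit C ?X \<otimes> Id C ?I) \<cdot> ((((?P \<otimes> Del C (A i)) \<otimes> Del C (A k)) \<cdot> swap_last ?Y (A k) (A i)) \<cdot> (?M \<otimes> Id C (A i)))"
        using P X obj k by simp
      also have "\<dots> = (Runit C ?X \<otimes> Id C ?I) \<cdot> (swap_last ?X ?I ?I \<cdot> (?Z \<otimes> Del C (A i)))"
        using swap_last_nat[of ?P "Del C (A k)" "Del C (A i)"] P X obj k by simp
      also have "\<dots> = Runit C (?X \<odot> ?I) \<cdot> (?Z \<otimes> Del C (A i))"
        using P X obj k by (subst comp_ext[OF swap_last_Unit(1)]) auto
      also have "\<dots> = Runit C (?X \<odot> ?I) \<cdot> ((?Z \<otimes> Id C ?I) \<cdot> (Id C (tensor_list C A js) \<otimes> Del C (A i)))"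
        using P X obj k by simp
      also have "\<dots> = ?Z \<cdot> (Runit C (tensor_list C A js) \<cdot> (Id C (tensor_list C A js) \<otimes> Del C (A i)))"
        using P X obj k comp_ext[OF Runit_nat[of ?Z], of "Id C (tensor_list C A js) \<otimes> Del C (A i)"]
        by (simp del: interchange interchange_ext)
      finally have "Runit C ?X \<cdot> (((Runit C ?X \<cdot> (?P \<otimes> Del C (A i))) \<otimes> Del C (A k)) \<cdot> (swap_last ?Y (A k) (A i) \<cdot> (?M \<otimes> Id C (A i)))) =
          (Runit C ?X \<cdot> ?Z) \<cdot> (Runit C (tensor_list C A js) \<cdot> (Id C (tensor_list C A js) \<otimes> Del C (A i)))"
        using P X obj k by simp
      also have "\<dots> = Runit C ?X \<cdot> ((proj_list C A F' js \<otimes> Id C ?I) \<cdot> (Id C (tensor_list C A js) \<otimes> Del C (A i)))"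
        unfolding IH using P X obj comp_ext[OF Runit_nat[of "proj_list C A F' js"], of "Id C (tensor_list C A js) \<otimes> Del C (A i)"]
        by (simp del: interchange)
      finally show ?thesis
        using F False P X obj k by (simp add: move_last_Cons fr del: move_last.simps)
    qed
  qed
qed simp

text \<open>This makes the finite permutations a compatible family, and thus a morphism of the Kolmogorov product.\<close>

lemma reorder_proj:
  assumes "distinct js" "distinct ks" "set js = set ks" "\<forall>j \<in> set ks. A j \<in> Obj C"
  shows "proj_list C A F' ks \<cdot> reorder C A js ks =
    reorder C A (filter (\<lambda>i. i \<in> F') js) (filter (\<lambda>i. i \<in> F') ks) \<cdot> proj_list C A F' js"
  using assms
proof (induction ks arbitrary: js)
  case (Cons k ks)
  let ?f = "filter (\<lambda>i. i \<in> F')" and ?js = "remove1 k js"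
  let ?P = "proj_list C A F'" and ?M = "move_last C A k" and ?R = "reorder C A"
  have js: "distinct ?js" "distinct ks" "set ?js = set ks" "k \<in> set js" "k \<notin> set ks"
    and obj: "\<forall>j \<in> set ks. A j \<in> Obj C" "A k \<in> Obj C" "\<forall>j \<in> set js. A j \<in> Obj C" "\<forall>j \<in> set ?js. A j \<in> Obj C"
    using Cons.prems by auto
  have IH: "?P ks \<cdot> ?R ?js ks = ?R (?f ?js) (?f ks) \<cdot> ?P ?js"
    using Cons.IH[of ?js] js obj by simp
  have fobj: "\<forall>j \<in> set (?f js). A j \<in> Obj C" "\<forall>j \<in> set (?f ?js). A j \<in> Obj C" "\<forall>j \<in> set (?f ks). A j \<in> Obj C"
    using obj by auto
  have fset: "distinct (?f ?js)" "distinct (?f ks)" "set (?f ?js) = set (?f ks)" using js by auto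
  show ?case
  proof (cases "k \<in> F'")
    case True
    have "(?P ks \<otimes> Id C (A k)) \<cdot> ((?R ?js ks \<otimes> Id C (A k)) \<cdot> ?M js) =
        (?R (?f ?js) (?f ks) \<otimes> Id C (A k)) \<cdot> ((?P ?js \<otimes> Id C (A k)) \<cdot> ?M js)"
      using js obj fobj fset IH by simp
    also have "\<dots> = (?R (?f ?js) (?f ks) \<otimes> Id C (A k)) \<cdot> (?M (?f js) \<cdot> ?P js)"
      using Cons.prems js obj True by (subst proj_move_last_in) auto
    finally show ?thesis
      using True js obj fobj fset by (simp add: filter_remove1 del: interchange interchange_ext)
  next
    case False
    have fr: "?f ?js = ?f js" using False by (simp add: filter_remove1 remove1_idem)
    have "Runit C (tensor_list C A (?f ks)) \<cdot> ((?P ks \<otimes> Del C (A k)) \<cdot> ((?R ?js ks \<otimes> Id C (A k)) \<cdot> ?M js)) =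
        (Runit C (tensor_list C A (?f ks)) \<cdot> (?R (?f js) (?f ks) \<otimes> Id C (Unit C))) \<cdot> ((?P ?js \<otimes> Del C (A k)) \<cdot> ?M js)"
      using js obj fobj fset IH fr by simp
    also have "\<dots> = ?R (?f js) (?f ks) \<cdot> (Runit C (tensor_list C A (?f js)) \<cdot> ((?P ?js \<otimes> Del C (A k)) \<cdot> ?M js))"
      using js obj fobj fset fr Runit_nat[of "?R (?f js) (?f ks)"] by (simp del: interchange interchange_ext)
    also have "\<dots> = ?R (?f js) (?f ks) \<cdot> ?P js"
      using Cons.prems js obj False by (subst proj_move_last_out) auto
    finally show ?thesis
      using False js obj fobj fset by (simp del: interchange interchange_ext)
  qed
qed simp

text \<open>The last two entries of a power may be exchanged because \<open>f\<close> is autocompatible.\<close>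

lemma move_last_power:
  assumes "compatible C f f" "k \<in> set js"
  shows "move_last C (\<lambda>_. Cod C f) k js \<cdot> pair_power C f (length js) = pair_power C f (length js)"
  using assms(2)
proof (induction js)
  case (Cons i js)
  note f = compatibleD(1)[OF assms(1)]
  show ?case
  proof (cases "i = k")
    case False
    then have k: "k \<in> set js" using Cons.prems by simp
    then have n: "length js = Suc (length (remove1 k js))" by (simp add: length_remove1) (metis length_pos_if_in_set Suc_pred)
    show ?thesis
      using False f k Cons.IH swap_last_pair[OF _ _ assms(1), of "pair_power C f (length (remove1 k js))"]
      by (simp add: move_last_Cons del: move_last.simps) (simp add: n)
  qed (use f in simp)
qed simp

lemma reorder_power:
  assumes "compatible C f f" "distinct js" "distinct ks" "set js = set ks"
  shows "reorder C (\<lambda>_. Cod C f) js ks \<cdot> pair_power C f (length js) = pair_power C f (length ks)"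
  using assms(2-)
proof (induction ks arbitrary: js)
  case (Cons k ks)
  note f = compatibleD(1)[OF assms(1)]
  let ?js = "remove1 k js"
  have js: "distinct ?js" "distinct ks" "set ?js = set ks" "k \<in> set js"
    using Cons.prems by auto
  then have n: "length js = Suc (length ?js)" by (simp add: length_remove1) (metis length_pos_if_in_set Suc_pred)
  show ?case
    using f js Cons.IH[of ?js] move_last_power[OF assms(1), of k js] by (simp add: n)
qed (use compatibleD(1)[OF assms(1)] in simp)

end

lemma desc_list_image:
  assumes "bij \<sigma>" "finite F"
  shows "distinct (map (inv \<sigma>) (desc_list (\<sigma> ` F)))" "set (map (inv \<sigma>) (desc_list (\<sigma> ` F))) = F"
    "length (map (inv \<sigma>) (desc_list (\<sigma> ` F))) = card F"
proof -
  show "set (map (inv \<sigma>) (desc_list (\<sigma> ` F))) = F"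
    using assms bij_is_inj[OF assms(1)] by (simp add: image_image)
  show "distinct (map (inv \<sigma>) (desc_list (\<sigma> ` F)))"
    using assms by (simp add: distinct_map bij_imp_bij_inv bij_is_inj inj_on_subset[OF bij_is_inj])
  show "length (map (inv \<sigma>) (desc_list (\<sigma> ` F))) = card F"
    using assms by (simp add: card_image inj_on_subset[OF bij_is_inj])
qed

text \<open>Relabelling along \<open>\<sigma>\<close>: \<open>fin_perm\<close> applies \<open>inv \<sigma>\<close> to the labels in \<open>\<sigma> ` F\<close>. As all factors are equal, only the
  selection of factors by projections has to be translated.\<close>

lemma inv_mem_iff: "bij \<sigma> \<Longrightarrow> inv \<sigma> j \<in> F \<longleftrightarrow> j \<in> \<sigma> ` F"
  by (metis bij_inv_eq_iff image_iff)

lemma filter_desc_list_image: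
  assumes "bij \<sigma>" "finite F" "F' \<subseteq> F"
  shows "filter (\<lambda>i. i \<in> F') (map (inv \<sigma>) (desc_list (\<sigma> ` F))) = map (inv \<sigma>) (desc_list (\<sigma> ` F'))"
  using filter_desc_list[of "\<sigma> ` F" "\<sigma> ` F'"] assms by (simp add: filter_map o_def inv_mem_iff image_mono)

lemma proj_list_relabel:
  assumes "bij \<sigma>"
  shows "proj_list C (\<lambda>_. X) F' (map (inv \<sigma>) js) = proj_list C (\<lambda>_. X) (\<sigma> ` F') js"
  by (induction js) (simp_all add: assms inv_mem_iff filter_map o_def)

context involutive_markov_category
begin

lemma fin_perm_arr [simp]:
  assumes "bij \<sigma>" "finite F" "X \<in> Obj C"
  shows "fin_perm C X \<sigma> F \<in> Arr C" "Dom C (fin_perm C X \<sigma> F) = tensor_power C X (card F)"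
    "Cod C (fin_perm C X \<sigma> F) = tensor_power C X (card F)"
  using assms desc_list_image[OF assms(1,2)]
    reorder_arr[of "map (inv \<sigma>) (desc_list (\<sigma> ` F))" "desc_list F" "\<lambda>_. X"]
  by (simp_all add: fin_perm_def)

lemma fin_perm_proj:
  assumes "bij \<sigma>" "finite F" "F' \<subseteq> F" "X \<in> Obj C"
  shows "fin_proj C (\<lambda>_. X) F F' \<cdot> fin_perm C X \<sigma> F =
    fin_perm C X \<sigma> F' \<cdot> fin_proj C (\<lambda>_. X) (\<sigma> ` F) (\<sigma> ` F')"
  using assms desc_list_image[OF assms(1,2)] filter_desc_list[OF assms(2,3)] filter_desc_list_image[OF assms(1-3)]
    reorder_proj[of "map (inv \<sigma>) (desc_list (\<sigma> ` F))" "desc_list F" "\<lambda>_. X" F']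
  by (simp add: fin_proj_def fin_perm_def proj_list_relabel)

lemma fin_perm_power:
  assumes "bij \<sigma>" "finite F" "compatible C f f"
  shows "fin_perm C (Cod C f) \<sigma> F \<cdot> pair_power C f (card F) = pair_power C f (card F)"
  using reorder_power[OF assms(3), of "map (inv \<sigma>) (desc_list (\<sigma> ` F))" "desc_list F"]
    assms desc_list_image[OF assms(1,2)] by (simp add: fin_perm_def)

lemma fin_proj_power:
  assumes "f \<in> Arr C" "finite F" "F' \<subseteq> F"
  shows "fin_proj C (\<lambda>_. Cod C f) F F' \<cdot> pair_power C f (card F) = pair_power C f (card F')"
  using proj_list_power[OF assms(1), of F' "desc_list F"] assms finite_subset[OF assms(3,2)]
  by (simp add: fin_proj_def filter_desc_list)

end

context picture
begin

lemma pair_power_D: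
  assumes "f \<in> D" "compatible C f f"
  shows "pair_power C f n \<in> D"
proof (induction n)
  case 0
  then show ?case using assms compatibleD(1)[OF assms(2)] by (simp add: D_Del)
next
  case (Suc n)
  then show ?case using assms by (auto intro!: D_pair compatible_power compatible_powers)
qed

lemma D_arr: "f \<in> D \<Longrightarrow> f \<in> Arr C"
  using D_Arr by blast

end

section \<open>Infinite powers\<close>

locale kolmogorov_power = picture C D + kolmogorov C D UNIV "\<lambda>_. X" K \<Phi>
  for C :: "('o, 'm, 'x) icd_data_scheme" (structure) and D X K \<Phi>
begin

lemma X_Obj [simp]: "X \<in> Obj C"
  using factors by simp

lemma fin_iff [simp]: "F \<in> Fpow UNIV \<longleftrightarrow> finite F"
  by (simp add: Fpow_def)

lemma T_eq [simp]: "finite F \<Longrightarrow> tensor_set C (\<lambda>_. X) F = tensor_power C X (card F)"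
  by (simp add: tensor_set_def)

text \<open>The definite description in \<open>inf_power\<close> denotes: the powers of \<open>f\<close> form a compatible family since deleting
  an entry of a power gives a smaller power. For autocompatible \<open>f\<close> in \<open>D\<close> the family lies in \<open>D\<close>, and the
  bijection for \<open>D\<close> gives the same morphism by uniqueness.\<close>

lemma inf_power:
  assumes f: "f \<in> Arr C" "Cod C f = X"
  shows "inf_power C X K \<Phi> f \<in> Arr C" "Dom C (inf_power C X K \<Phi> f) = Dom C f" "Cod C (inf_power C X K \<Phi> f) = K"
    "\<And>F. finite F \<Longrightarrow> marg F \<cdot> inf_power C X K \<Phi> f = pair_power C f (card F)"
    "f \<in> D \<Longrightarrow> compatible C f f \<Longrightarrow> inf_power C X K \<Phi> f \<in> D"
proof -
  let ?Q = "\<lambda>g. g \<in> hom C (Dom C f) K \<and> (\<forall>F. finite F \<longrightarrow> marg F \<cdot> g = pair_power C f (card F))"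
  have eq: "inf_power C X K \<Phi> f = g" if g: "?Q g" for g
    unfolding inf_power_def
  proof (rule the_equality)
    show "?Q g" by (rule g)
    show "h = g" if "?Q h" for h
      by (rule marg_jointly_monic) (use that g in \<open>auto simp: hom_def\<close>)
  qed
  have proj: "fin_proj C (\<lambda>_. X) F F' \<cdot> pair_power C f (card F) = pair_power C f (card F')"
    if "finite F" "F' \<subseteq> F" for F F'
    using fin_proj_power[of f F F'] that f by simp
  have "\<exists>g \<in> Arr C \<inter> Arr C. Dom C g = Dom C f \<and> Cod C g = K \<and>
      (\<forall>F. F \<in> Fpow UNIV \<longrightarrow> marg F \<cdot> g = pair_power C f (card F))"
  proof (rule marg_universal)
    fix F F' assume "F \<in> Fpow (UNIV :: nat set)" "F' \<subseteq> F"
    then show "fin_proj C (\<lambda>_. X) F F' \<cdot> pair_power C f (card F) = pair_power C f (card F')"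
      by (intro proj) simp_all
  qed (simp_all add: f)
  then obtain g where "?Q g" by (auto simp: hom_def)
  then have "?Q (inf_power C X K \<Phi> f)" using eq[of g] by simp
  then show "inf_power C X K \<Phi> f \<in> Arr C" "Dom C (inf_power C X K \<Phi> f) = Dom C f" "Cod C (inf_power C X K \<Phi> f) = K"
    "\<And>F. finite F \<Longrightarrow> marg F \<cdot> inf_power C X K \<Phi> f = pair_power C f (card F)"
    by (auto simp: hom_def)
  assume D: "f \<in> D" "compatible C f f"
  have "inv_arr C (Runit C (tensor_power C X n)) \<cdot> pair_power C f m \<in> D" if "n = m" for n m
    using that D f by (intro D_Comp pair_power_D conjunct2[OF D_Runit]) auto
  moreover have "Runit C K \<cdot> x \<in> D" if "x \<in> D" "Cod C x = K \<odot> Unit C" for x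
    using that by (intro D_Comp conjunct1[OF D_Runit]) auto
  ultimately have "\<exists>g \<in> Arr C \<inter> D. Dom C g = Dom C f \<and> Cod C g = K \<and>
      (\<forall>F. F \<in> Fpow UNIV \<longrightarrow> marg F \<cdot> g = pair_power C f (card F))"
    by (intro marg_universal) (use f proj in auto)
  then obtain g where "g \<in> D" "?Q g" by (auto simp: hom_def)
  then show "inf_power C X K \<Phi> f \<in> D" using eq[of g] by simp
qed

text \<open>The definite description in \<open>inf_perm\<close> denotes, by \<open>fin_perm_proj\<close>.\<close>

lemma inf_perm:
  assumes \<sigma>: "bij \<sigma>"
  shows "inf_perm C X K \<Phi> \<sigma> \<in> Arr C" "Dom C (inf_perm C X K \<Phi> \<sigma>) = K" "Cod C (inf_perm C X K \<Phi> \<sigma>) = K"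
    "\<And>F. finite F \<Longrightarrow> marg F \<cdot> inf_perm C X K \<Phi> \<sigma> = fin_perm C X \<sigma> F \<cdot> marg (\<sigma> ` F)"
proof -
  let ?Q = "\<lambda>g. g \<in> hom C K K \<and> (\<forall>F. finite F \<longrightarrow> marg F \<cdot> g = fin_perm C X \<sigma> F \<cdot> marg (\<sigma> ` F))"
  have eq: "inf_perm C X K \<Phi> \<sigma> = g" if g: "?Q g" for g
    unfolding inf_perm_def
  proof (rule the_equality)
    show "?Q g" by (rule g)
    show "h = g" if "?Q h" for h
      by (rule marg_jointly_monic) (use that g in \<open>auto simp: hom_def\<close>)
  qed
  have card: "card (\<sigma> ` F) = card F" for F
    using \<sigma> by (intro card_image inj_on_subset[OF bij_is_inj]) auto
  have proj: "fin_proj C (\<lambda>_. X) F F' \<cdot> (fin_perm C X \<sigma> F \<cdot> marg (\<sigma> ` F)) = fin_perm C X \<sigma> F' \<cdot> marg (\<sigma> ` F')"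
    if "finite F" "F' \<subseteq> F" for F F'
  proof -
    have F': "finite F'" using that finite_subset by blast
    have "fin_proj C (\<lambda>_. X) F F' \<cdot> (fin_perm C X \<sigma> F \<cdot> marg (\<sigma> ` F)) =
        (fin_perm C X \<sigma> F' \<cdot> fin_proj C (\<lambda>_. X) (\<sigma> ` F) (\<sigma> ` F')) \<cdot> marg (\<sigma> ` F)"
      using that F' \<sigma> by (intro comp_ext fin_perm_proj) (auto simp: card)
    also have "\<dots> = fin_perm C X \<sigma> F' \<cdot> marg (\<sigma> ` F')"
      using that F' \<sigma> marg_proj[of "\<sigma> ` F" "\<sigma> ` F'"] by (simp add: card image_mono)
    finally show ?thesis .
  qed
  have "\<exists>g \<in> Arr C \<inter> Arr C. Dom C g = K \<and> Cod C g = K \<and>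
      (\<forall>F. F \<in> Fpow UNIV \<longrightarrow> marg F \<cdot> g = fin_perm C X \<sigma> F \<cdot> marg (\<sigma> ` F))"
  proof (rule marg_universal)
    fix F F' assume "F \<in> Fpow (UNIV :: nat set)" "F' \<subseteq> F"
    then show "fin_proj C (\<lambda>_. X) F F' \<cdot> (fin_perm C X \<sigma> F \<cdot> marg (\<sigma> ` F)) = fin_perm C X \<sigma> F' \<cdot> marg (\<sigma> ` F')"
      by (intro proj) simp_all
  qed (simp_all add: \<sigma> card)
  then obtain g where "?Q g" by (auto simp: hom_def)
  then have "?Q (inf_perm C X K \<Phi> \<sigma>)" using eq[of g] by simp
  then show "inf_perm C X K \<Phi> \<sigma> \<in> Arr C" "Dom C (inf_perm C X K \<Phi> \<sigma>) = K" "Cod C (inf_perm C X K \<Phi> \<sigma>) = K"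
    "\<And>F. finite F \<Longrightarrow> marg F \<cdot> inf_perm C X K \<Phi> \<sigma> = fin_perm C X \<sigma> F \<cdot> marg (\<sigma> ` F)"
    by (auto simp: hom_def)
qed

lemma inf_perm_power:
  assumes \<sigma>: "bij \<sigma>" and f: "Cod C f = X" "compatible C f f"
  shows "inf_perm C X K \<Phi> \<sigma> \<cdot> inf_power C X K \<Phi> f = inf_power C X K \<Phi> f"
proof (rule marg_jointly_monic)
  note a = compatibleD(1)[OF f(2)]
  note e = inf_power(1-4)[OF a f(1)] and s = inf_perm[OF \<sigma>]
  show "inf_perm C X K \<Phi> \<sigma> \<cdot> inf_power C X K \<Phi> f \<in> Arr C" "inf_power C X K \<Phi> f \<in> Arr C"
    "Dom C (inf_perm C X K \<Phi> \<sigma> \<cdot> inf_power C X K \<Phi> f) = Dom C (inf_power C X K \<Phi> f)"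
    "Cod C (inf_perm C X K \<Phi> \<sigma> \<cdot> inf_power C X K \<Phi> f) = K" "Cod C (inf_power C X K \<Phi> f) = K"
    using e s by simp_all
  fix F assume "F \<in> Fpow (UNIV :: nat set)"
  then have F: "finite F" "finite (\<sigma> ` F)" by auto
  have card: "card (\<sigma> ` F) = card F"
    using \<sigma> by (intro card_image inj_on_subset[OF bij_is_inj]) auto
  have "marg F \<cdot> (inf_perm C X K \<Phi> \<sigma> \<cdot> inf_power C X K \<Phi> f) =
      (fin_perm C X \<sigma> F \<cdot> marg (\<sigma> ` F)) \<cdot> inf_power C X K \<Phi> f"
    using e(1-3) s(1-3) F by (intro comp_ext s(4)) auto
  also have "\<dots> = pair_power C f (card F)"
    using e F \<sigma> fin_perm_power[OF \<sigma> F(1) f(2)] f(1) by (simp add: card)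
  finally show "marg F \<cdot> (inf_perm C X K \<Phi> \<sigma> \<cdot> inf_power C X K \<Phi> f) = marg F \<cdot> inf_power C X K \<Phi> f"
    using e F by simp
qed

lemma inf_power_Det:
  assumes f: "f \<in> Arr C" "Cod C f = X" and g: "g \<in> Det C" "Cod C g = Dom C f"
  shows "inf_power C X K \<Phi> f \<cdot> g = inf_power C X K \<Phi> (f \<cdot> g)"
proof -
  note a = Det_arr[OF g(1)]
  note e = inf_power(1-4)[OF f] and e' = inf_power(1-4)[of "f \<cdot> g"]
  show ?thesis
  proof (rule marg_jointly_monic)
    fix F assume "F \<in> Fpow (UNIV :: nat set)"
    then have F: "finite F" by simp
    show "marg F \<cdot> (inf_power C X K \<Phi> f \<cdot> g) = marg F \<cdot> inf_power C X K \<Phi> (f \<cdot> g)"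
      using a e' f g F comp_ext[OF e(4)[OF F], of g] e(1-3) by (simp add: pair_power_Det)
  qed (use a e e' f g in auto)
qed

end

section \<open>De Finetti objects\<close>

text \<open>\<open>K\<close> and \<open>\<Phi>\<close> are the Kolmogorov product with respect to which \<open>Q\<close> is a de Finetti object.\<close>

locale de_finetti = kolmogorov_power C D A K \<Phi>
  for C :: "('o, 'm, 'x) icd_data_scheme" (structure) and D A K \<Phi> +
  fixes Q :: 'o and l :: 'm
  assumes l: "l \<in> hom C Q A \<inter> D" and l_compatible: "compatible C l l"
    and equalizer: "is_equalizer C D Q K K
      (inf_perm C A K \<Phi> ` {\<sigma>. bij \<sigma> \<and> finite {n. \<sigma> n \<noteq> n}}) (inf_power C A K \<Phi> l)"
    and monic: "B \<in> Obj C \<Longrightarrow> monic C (inf_power C A K \<Phi> l \<otimes> Id C B)"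
begin

abbreviation e where "e \<equiv> inf_power C A K \<Phi> l"

lemma l_arr [simp]: "l \<in> Arr C" "Dom C l = Q" "Cod C l = A" "l \<in> D"
  using l by (auto simp: hom_def)

lemma Q_Obj [simp]: "Q \<in> Obj C"
  using l_arr Dom_Cod_Obj(1)[of l] by simp

lemma e_arr [simp]: "e \<in> Arr C" "Dom C e = Q" "Cod C e = K"
  using inf_power(1-3)[of l] by simp_all

lemma marg_e [simp]: "finite F \<Longrightarrow> marg F \<cdot> e = pair_power C l (card F)"
  using inf_power(4)[of l] by simp

lemma tensor_e_monic:
  assumes "x \<in> Arr C" "y \<in> Arr C" "Dom C x = Dom C y" "Cod C x = Q \<odot> B" "Cod C y = Q \<odot> B" "B \<in> Obj C"
    "(e \<otimes> Id C B) \<cdot> x = (e \<otimes> Id C B) \<cdot> y"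
  shows "x = y"
proof -
  have "x \<in> hom C (Dom C y) (Dom C (e \<otimes> Id C B))" "y \<in> hom C (Dom C y) (Dom C (e \<otimes> Id C B))"
    using assms by (auto simp: hom_def)
  then show ?thesis using monic[OF assms(6)] assms(2,7) unfolding monic_def by (meson Dom_Cod_Obj(1))
qed

lemma e_monic:
  assumes "x \<in> Arr C" "y \<in> Arr C" "Dom C x = Dom C y" "Cod C x = Q" "Cod C y = Q" "e \<cdot> x = e \<cdot> y"
  shows "x = y"
proof -
  have "(e \<otimes> Id C (Unit C)) \<cdot> (inv_arr C (Runit C Q) \<cdot> z) = inv_arr C (Runit C K) \<cdot> (e \<cdot> z)"
    if "z \<in> Arr C" "Cod C z = Q" for z
    using that comp_ext[OF Runit_inv_nat[of e], of z] by simp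
  then have "inv_arr C (Runit C Q) \<cdot> x = inv_arr C (Runit C Q) \<cdot> y"
    by (rule_tac tensor_e_monic[where B = "Unit C"]) (use assms in auto)
  then have "Runit C Q \<cdot> (inv_arr C (Runit C Q) \<cdot> x) = Runit C Q \<cdot> (inv_arr C (Runit C Q) \<cdot> y)"
    by simp
  then show ?thesis using assms by simp
qed

text \<open>\<open>e \<odot> e\<close> is \<open>e \<odot> id\<close> after \<open>id \<odot> e\<close>, and the latter is \<open>e \<odot> id\<close> up to swaps.\<close>

lemma e_tensor_e_monic:
  assumes xy: "x \<in> Arr C" "y \<in> Arr C" "Dom C x = Dom C y" "Cod C x = Q \<odot> Q" "Cod C y = Q \<odot> Q"
    and eq: "(e \<otimes> e) \<cdot> x = (e \<otimes> e) \<cdot> y"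
  shows "x = y"
proof -
  have "(Id C Q \<otimes> e) \<cdot> x = (Id C Q \<otimes> e) \<cdot> y"
    by (rule tensor_e_monic[where B = K]) (use xy eq in auto)
  moreover have "(e \<otimes> Id C Q) \<cdot> (Swap C Q Q \<cdot> z) = Swap C Q K \<cdot> ((Id C Q \<otimes> e) \<cdot> z)"
    if "z \<in> Arr C" "Cod C z = Q \<odot> Q" for z
    using that comp_ext[OF Swap_nat[of "Id C Q" e], of z] by simp
  ultimately have "Swap C Q Q \<cdot> x = Swap C Q Q \<cdot> y"
    by (rule_tac tensor_e_monic[where B = Q]) (use xy in auto)
  then show ?thesis by (rule iso_cancel_left) (use xy in auto)
qed

text \<open>The marginals of \<open>e \<odot> e\<close> are the pairs of powers of \<open>l\<close>.\<close>

lemma eq_if_powers_eq: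
  assumes xy: "x \<in> Arr C" "y \<in> Arr C" "Dom C x = Dom C y" "Cod C x = Q \<odot> Q" "Cod C y = Q \<odot> Q"
    and eq: "\<And>m n. (pair_power C l m \<otimes> pair_power C l n) \<cdot> x = (pair_power C l m \<otimes> pair_power C l n) \<cdot> y"
  shows "x = y"
proof (rule e_tensor_e_monic[OF xy])
  show "(e \<otimes> e) \<cdot> x = (e \<otimes> e) \<cdot> y"
    by (rule marg_tensor_marg_jointly_monic) (use xy eq in auto)
qed

lemma Q_classical: "classical C Q"
  unfolding classical_def
proof (intro conjI)
  show "Swap C Q Q \<cdot> Copy C Q = Copy C Q"
  proof (rule eq_if_powers_eq)
    fix m n
    let ?m = "pair_power C l m" and ?n = "pair_power C l n"
    have "(?m \<otimes> ?n) \<cdot> (Swap C Q Q \<cdot> Copy C Q) = Swap C (Cod C ?n) (Cod C ?m) \<cdot> \<langle>?n, ?m\<rangle>"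
      using comp_ext[OF Swap_nat[of ?n ?m], of "Copy C Q"] by (simp add: pair_def)
    also have "\<dots> = \<langle>?m, ?n\<rangle>"
      using compatibleD(4)[OF compatible_powers[OF l_compatible]] .
    finally show "(?m \<otimes> ?n) \<cdot> (Swap C Q Q \<cdot> Copy C Q) = (?m \<otimes> ?n) \<cdot> Copy C Q"
      by (simp add: pair_def)
  qed auto
qed simp

text \<open>The marginals of \<open>e g = f\<^sup>(\<^sup>\<nat>\<^sup>)\<close> are the equations \<open>l\<^sup>(\<^sup>n\<^sup>) g = f\<^sup>(\<^sup>n\<^sup>)\<close>. Tested on powers, \<open>copy g\<close> becomes a splitting of
  \<open>l\<^sup>(\<^sup>m\<^sup>+\<^sup>n\<^sup>) g = f\<^sup>(\<^sup>m\<^sup>+\<^sup>n\<^sup>)\<close>, which is \<open>(f\<^sup>(\<^sup>m\<^sup>), f\<^sup>(\<^sup>n\<^sup>)) = (l\<^sup>(\<^sup>m\<^sup>) g, l\<^sup>(\<^sup>n\<^sup>) g)\<close>.\<close>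

lemma Det_if_power:
  assumes f: "f \<in> Arr C" "Cod C f = A" and g: "g \<in> D" "Dom C g = Dom C f" "Cod C g = Q"
    and eg: "e \<cdot> g = inf_power C A K \<Phi> f"
  shows "g \<in> Det C"
proof (rule DetI)
  show ga: "g \<in> Arr C" using g by (simp add: D_arr)
  show "self_adjoint C g" using g by (simp add: D_self_adjoint)
  have pg: "pair_power C l n \<cdot> g = pair_power C f n" for n
  proof -
    have "pair_power C l n \<cdot> g = marg {..<n} \<cdot> (e \<cdot> g)"
      using ga g by (subst comp_ext[OF marg_e]) auto
    then show ?thesis using inf_power(4)[OF f, of "{..<n}"] by (simp add: eg)
  qed
  have "Copy C Q \<cdot> g = \<langle>g, g\<rangle>"
  proof (rule eq_if_powers_eq)
    fix m n
    obtain s where s: "s \<in> Arr C" "Dom C s = tensor_power C A (m + n)"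
      "\<And>f. f \<in> Arr C \<Longrightarrow> Cod C f = A \<Longrightarrow> s \<cdot> pair_power C f (m + n) = \<langle>pair_power C f m, pair_power C f n\<rangle>"
      using pair_power_split[of A m n] by auto
    have "(pair_power C l m \<otimes> pair_power C l n) \<cdot> (Copy C Q \<cdot> g) = (s \<cdot> pair_power C l (m + n)) \<cdot> g"
      using ga g s(3)[of l] by (simp add: pair_def)
    also have "\<dots> = s \<cdot> pair_power C f (m + n)"
      using ga g s(1,2) by (simp add: pg)
    also have "\<dots> = (pair_power C l m \<otimes> pair_power C l n) \<cdot> \<langle>g, g\<rangle>"
      using ga g f s(3)[of f] by (simp add: pg)
    finally show "(pair_power C l m \<otimes> pair_power C l n) \<cdot> (Copy C Q \<cdot> g) = (pair_power C l m \<otimes> pair_power C l n) \<cdot> \<langle>g, g\<rangle>" .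
  qed (use ga g in auto)
  then show "Copy C (Cod C g) \<cdot> g = \<langle>g, g\<rangle>" using g by simp
qed

lemma factorization:
  assumes B: "classical C B" and f: "f \<in> hom C B A \<inter> D"
  obtains g where "g \<in> hom C B Q" "g \<in> D" "g \<in> Det C" "l \<cdot> g = f"
proof -
  let ?S = "inf_perm C A K \<Phi> ` {\<sigma>. bij \<sigma> \<and> finite {n. \<sigma> n \<noteq> n}}" and ?F = "inf_power C A K \<Phi> f"
  have fa: "f \<in> Arr C" "Dom C f = B" "Cod C f = A" "f \<in> D" using f by (auto simp: hom_def)
  have compat: "compatible C f f" using classical_compatible[OF B] fa by simp
  note F = inf_power[OF fa(1,3)]
  have F_mem: "?F \<in> hom C B K \<inter> D" using F fa compat by (simp add: in_homI)
  have F_inv: "\<forall>s \<in> ?S. \<forall>t \<in> ?S. s \<cdot> ?F = t \<cdot> ?F"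
    using inf_perm_power[OF _ fa(3) compat] by auto
  have B_Obj: "B \<in> Obj C" using B by (simp add: classical_def)
  have "\<forall>B \<in> Obj C. \<forall>f \<in> hom C B K \<inter> D. (\<forall>s \<in> ?S. \<forall>t \<in> ?S. s \<cdot> f = t \<cdot> f) \<longrightarrow>
      (\<exists>!g. g \<in> hom C B Q \<inter> D \<and> e \<cdot> g = f)"
    using equalizer unfolding is_equalizer_def by (elim conjE)
  from this[THEN bspec, OF B_Obj, THEN bspec, OF F_mem, THEN mp, OF F_inv]
  have "\<exists>!g. g \<in> hom C B Q \<inter> D \<and> e \<cdot> g = ?F" .
  then obtain g where g: "g \<in> hom C B Q" "g \<in> D" "e \<cdot> g = ?F" by blast
  have ga: "g \<in> Arr C" "Dom C g = B" "Cod C g = Q" using g by (auto simp: hom_def)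
  \<comment> \<open>The power \<open>l\<^sup>(\<^sup>1\<^sup>)\<close> is \<open>(del, l)\<close>, so \<open>l\<close> is recovered from the marginal on one factor.\<close>
  have "l \<cdot> g = Lunit C A \<cdot> (pair_power C l 1 \<cdot> g)"
    using ga pair_power_1[of l] by (subst comp_ext) auto
  also have "pair_power C l 1 \<cdot> g = marg {0} \<cdot> (e \<cdot> g)"
    using ga by (subst comp_ext[OF marg_e]) auto
  also have "Lunit C A \<cdot> \<dots> = f"
    using g(3) F(4)[of "{0}"] pair_power_1[of f] fa by simp
  finally have "l \<cdot> g = f" .
  moreover have "g \<in> Det C" using Det_if_power[of f g] fa ga g by simp
  ultimately show ?thesis using that g by blast
qed

lemma state_space: "state_space_object C D A Q l"
  unfolding state_space_object_def
proof (intro conjI allI impI)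
  show "classical C Q" by (rule Q_classical)
  show "l \<in> hom C Q A \<inter> D" by (rule l)
  fix B assume B: "classical C B"
  show "bij_betw (\<lambda>f. l \<cdot> f) (hom C B Q \<inter> (D \<inter> Det C)) (hom C B A \<inter> D)"
    unfolding bij_betw_def
  proof
    show "inj_on (\<lambda>f. l \<cdot> f) (hom C B Q \<inter> (D \<inter> Det C))"
    proof (rule inj_onI)
      fix g h assume gh: "g \<in> hom C B Q \<inter> (D \<inter> Det C)" "h \<in> hom C B Q \<inter> (D \<inter> Det C)" "l \<cdot> g = l \<cdot> h"
      then have a: "g \<in> Arr C" "Dom C g = B" "Cod C g = Q" "g \<in> Det C" "h \<in> Arr C" "Dom C h = B" "Cod C h = Q" "h \<in> Det C"
        by (auto simp: hom_def)
      have "e \<cdot> g = e \<cdot> h"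
        using a inf_power_Det[of l g] inf_power_Det[of l h] gh(3) by simp
      then show "g = h" by (rule e_monic[rotated -1]) (use a in auto)
    qed
    show "(\<lambda>f. l \<cdot> f) ` (hom C B Q \<inter> (D \<inter> Det C)) = hom C B A \<inter> D"
    proof
      show "(\<lambda>f. l \<cdot> f) ` (hom C B Q \<inter> (D \<inter> Det C)) \<subseteq> hom C B A \<inter> D"
        by (auto simp: hom_def intro: D_Comp)
      show "hom C B A \<inter> D \<subseteq> (\<lambda>f. l \<cdot> f) ` (hom C B Q \<inter> (D \<inter> Det C))"
      proof
        fix f assume "f \<in> hom C B A \<inter> D"
        from factorization[OF B this] show "f \<in> (\<lambda>f. l \<cdot> f) ` (hom C B Q \<inter> (D \<inter> Det C))" by blast
      qed
    qed
  qed
qed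

end

theorem theorem4p35:
  fixes C :: "('o, 'm, 'x) icd_data_scheme" and D :: "'m set" and A QA :: 'o and l :: 'm
  assumes "picture C D"
    and "has_countable_kolmogorov_products C D"
    and "A \<in> Obj C"
    and "de_finetti_object C D A QA l"
  shows "state_space_object C D A QA l"
proof -
  obtain K \<Phi> where K: "kolmogorov_product C D UNIV (\<lambda>_. A) K \<Phi>"
    and eq: "is_equalizer C D QA K K (inf_perm C A K \<Phi> ` {\<sigma>. bij \<sigma> \<and> finite {n. \<sigma> n \<noteq> n}}) (inf_power C A K \<Phi> l)"
    and mon: "\<forall>B \<in> Obj C. monic C (inf_power C A K \<Phi> l \<otimes>\<^bsub>C\<^esub> Id C B)"
    using assms(4) unfolding de_finetti_object_def Let_def by blast
  interpret picture C D by (rule assms(1))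
  interpret de_finetti C D A K \<Phi> QA l
    by unfold_locales (use assms K eq mon in \<open>auto simp: de_finetti_object_def\<close>)
  show ?thesis by (rule state_space)
qed

end
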